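(* For any $\lambda>0$, with $\lambda_m:=\lambda\sqrt{m}$, the vacuum law of $$ \frac{T_m(\lambda_m)}{\sqrt{m}}=\frac{G_1+\cdots+G_m+\lambda_m(A^0_1+\cdots+A^0_m)}{\sqrt{m}} $$ converges weakly, as $m\to\infty$, to the free Meixner distribution $\nu_\lambda$ with parameters $(a,b,c,\alpha)=\left(\lambda,\frac12,2,0\right)$. Namely, $$ \nu_\lambda=\frac{\lambda}{\sqrt{\lambda^2+2}}\,\delta_{\lambda-\sqrt{\lambda^2+2}}+\nu_\lambda^{\text{a.c.}}, $$ where the absolutely continuous part (w.r.t. the Lebesgue measure) $\nu_\lambda^{\text{a.c.}}$ has the density $$ \nu_\lambda^{\text{a.c.}}(dx)=\frac{\sqrt{2-(x-\lambda)^2}}{\pi(\lambda^2+2-(x-\lambda)^2)}\chi_{(\lambda-\sqrt2,\lambda+\sqrt2)}(x). $$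
   Context: Let $\mathcal{H}$ be a separable Hilbert space with a fixed orthonormal basis $(e_i)_{i\ge1}$. The weakly monotone Fock space is the closed subspace of the full Fock space on $\mathcal{H}$ (with vacuum vector $\Omega=1\oplus 0\oplus\cdots$) spanned by $\Omega$, $\mathcal{H}$ and all simple tensors $e_{i_k}\otimes e_{i_{k-1}}\otimes\cdots\otimes e_{i_1}$ with $i_k\ge i_{k-1}\ge\cdots\ge i_1$, $k\ge2$. For $i\geq 1$, the annihilation operator $A_i$ and the creation operator $A_i^{\dagger}$ are the mutually adjoint bounded operators on it determined by: $A_i\Omega=0$, $A_i e_j=\delta_{i,j}\Omega$, $A_i(e_{i_k}\otimes e_{i_{k-1}}\otimes\cdots\otimes e_{i_1})=\delta_{i,i_k}\,e_{i_{k-1}}\otimes\cdots\otimes e_{i_1}$; $A_i^{\dagger}\Omega=e_i$, $A_i^{\dagger}(e_{i_k}\otimes\cdots\otimes e_{i_1})=e_i\otimes e_{i_k}\otimes\cdots\otimes e_{i_1}$ if $i\ge i_k$ and $0$ otherwise ($k\ge1$). Put $G_i:=A_i+A_i^{\dagger}$, $A_i^0:=A_i^{\dagger}A_i$, and $T_m(\lambda_m):=\sum_{k=1}^m(G_k+\lambda_m A_k^0)$. The vacuum law of a bounded selfadjoint operator $T$ is the unique probability measure $\mu$ on $\mathbb{R}$ with $\int x^n\,\mu(dx)=\langle T^n\Omega,\Omega\rangle$ for all $n\ge0$. The free Meixner law with parameters $(a,b,c,\alpha)$ ($b,c\ge0$) is the probability measure on $\mathbb{R}$ orthogonalizing the polynomials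 $P_0(x)=c$, $P_1(x)=x-\alpha$, $P_{n+1}(x)=(x-a)P_n(x)-bP_{n-1}(x)$ for $n\ge1$. $\chi_S$ is the indicator function of $S$, and $\delta_x$ the Dirac measure at $x$. *)

theory Defs
  imports "HOL-Probability.Probability"
begin

section \<open>The weakly monotone Fock space\<close>

text \<open>
  The full Fock space over a complex Hilbert space with orthonormal basis
  \<open>e\<^sub>1, e\<^sub>2, \<dots>\<close> has the orthonormal basis consisting of \<open>\<Omega>\<close> and all simple tensors of basis
  vectors. A vector is represented by its coordinates in that basis: the word
  \<open>[j\<^sub>1, \<dots>, j\<^sub>n]\<close> is the index of \<open>e\<^sub>j\<^sub>1 \<otimes> \<cdots> \<otimes> e\<^sub>j\<^sub>n\<close>, written in the same order, and the empty
  word is the index of \<open>\<Omega>\<close>. So the head of a word is the leftmost tensor factor.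
\<close>

type_synonym fock_vec = "nat list \<Rightarrow> complex"

definition fock :: "fock_vec set" where
  "fock = {f. (\<forall>w. w \<notin> lists {1..} \<longrightarrow> f w = 0) \<and> (\<lambda>w. (cmod (f w))\<^sup>2) summable_on UNIV}"

definition fock_inner :: "fock_vec \<Rightarrow> fock_vec \<Rightarrow> complex" where
  "fock_inner f g = (\<Sum>\<^sub>\<infinity>w. f w * cnj (g w))"

definition fock_norm :: "fock_vec \<Rightarrow> real" where
  "fock_norm f = sqrt (\<Sum>\<^sub>\<infinity>w. (cmod (f w))\<^sup>2)"

definition tensor :: "nat list \<Rightarrow> fock_vec" where
  "tensor w = (\<lambda>v. if v = w then 1 else 0)"

abbreviation vacuum :: fock_vec where
  "vacuum \<equiv> tensor []"

definition wm_words :: "nat list set" where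
  "wm_words = {w \<in> lists {1..}. sorted_wrt (\<ge>) w}"

text \<open>The closed linear span, in the full Fock space, of the simple tensors with index in
  \<^const>\<open>wm_words\<close>:\<close>

definition wm_fock :: "fock_vec set" where
  "wm_fock = {f \<in> fock. \<forall>\<epsilon>>0. \<exists>S c. finite S \<and> S \<subseteq> wm_words \<and>
     fock_norm (\<lambda>v. f v - (\<Sum>w\<in>S. c w * tensor w v)) < \<epsilon>}"


section \<open>Annihilation and creation operators\<close>

definition annih_basis :: "nat \<Rightarrow> nat list \<Rightarrow> fock_vec" where
  "annih_basis i w = (case w of [] \<Rightarrow> (\<lambda>_. 0)
                      | j # v \<Rightarrow> if j = i then tensor v else (\<lambda>_. 0))"

definition creat_basis :: "nat \<Rightarrow> nat list \<Rightarrow> fock_vec" where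
  "creat_basis i w = (case w of [] \<Rightarrow> tensor [i]
                      | j # v \<Rightarrow> if j \<le> i then tensor (i # j # v) else (\<lambda>_. 0))"

text \<open>The extension to \<^const>\<open>wm_fock\<close>, by linearity and continuity, of an assignment of vectors
  to the basis of \<^const>\<open>wm_fock\<close>. In the two cases used below, at most one term of each
  coordinate sum is nonzero.\<close>

definition wm_extend :: "(nat list \<Rightarrow> fock_vec) \<Rightarrow> fock_vec \<Rightarrow> fock_vec" where
  "wm_extend B f = (\<lambda>v. \<Sum>\<^sub>\<infinity>w\<in>wm_words. f w * B w v)"

definition annih :: "nat \<Rightarrow> fock_vec \<Rightarrow> fock_vec" where
  "annih i = wm_extend (annih_basis i)"

definition creat :: "nat \<Rightarrow> fock_vec \<Rightarrow> fock_vec" where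
  "creat i = wm_extend (creat_basis i)"

definition gaussian_op :: "nat \<Rightarrow> fock_vec \<Rightarrow> fock_vec" where
  "gaussian_op i f = (\<lambda>w. annih i f w + creat i f w)"

definition number_op :: "nat \<Rightarrow> fock_vec \<Rightarrow> fock_vec" where
  "number_op i f = creat i (annih i f)"

definition T_op :: "nat \<Rightarrow> real \<Rightarrow> fock_vec \<Rightarrow> fock_vec" where
  "T_op m l f = (\<lambda>w. \<Sum>k=1..m. gaussian_op k f w + complex_of_real l * number_op k f w)"


section \<open>Vacuum laws and free Meixner laws\<close>

definition vacuum_law :: "(fock_vec \<Rightarrow> fock_vec) \<Rightarrow> real measure" where
  "vacuum_law T = (THE \<mu>. real_distribution \<mu> \<and>
     (\<forall>n. integrable \<mu> (\<lambda>x. x ^ n) \<and>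
          complex_of_real (LINT x|\<mu>. x ^ n) = fock_inner ((T ^^ n) vacuum) vacuum))"

fun meixner_poly :: "real \<Rightarrow> real \<Rightarrow> real \<Rightarrow> real \<Rightarrow> nat \<Rightarrow> real poly" where
  "meixner_poly a b c \<alpha> 0 = [:c:]"
| "meixner_poly a b c \<alpha> (Suc 0) = [:-\<alpha>, 1:]"
| "meixner_poly a b c \<alpha> (Suc (Suc n)) =
     [:-a, 1:] * meixner_poly a b c \<alpha> (Suc n) - smult b (meixner_poly a b c \<alpha> n)"

text \<open>For \<open>c = 0\<close> the polynomial of degree 0 vanishes and orthogonality does not single out one
  measure; the definition is meant for \<open>b \<ge> 0\<close> and \<open>c > 0\<close>.\<close>

definition free_meixner_law :: "real \<Rightarrow> real \<Rightarrow> real \<Rightarrow> real \<Rightarrow> real measure" where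
  "free_meixner_law a b c \<alpha> = (THE \<mu>. real_distribution \<mu> \<and>
     (\<forall>n. integrable \<mu> (\<lambda>x. x ^ n)) \<and>
     (\<forall>m n. m \<noteq> n \<longrightarrow>
        (LINT x|\<mu>. poly (meixner_poly a b c \<alpha> m) x * poly (meixner_poly a b c \<alpha> n) x) = 0))"


section \<open>The operators are the ones described by their action on the basis\<close>

lemma wm_words_Nil [simp]: "[] \<in> wm_words"
  by (simp add: wm_words_def)

lemma wm_words_Cons_tl: "i # w \<in> wm_words \<Longrightarrow> w \<in> wm_words"
  by (simp add: wm_words_def)

lemma wm_words_single [simp]: "[i] \<in> wm_words \<longleftrightarrow> i \<ge> 1"
  by (simp add: wm_words_def)

lemma wm_words_Cons_Cons [simp]:
  "i # j # w \<in> wm_words \<longleftrightarrow> i \<ge> j \<and> j # w \<in> wm_words"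
  by (auto simp: wm_words_def)

lemma infsum_one_term:
  assumes "\<And>w. w \<in> A \<Longrightarrow> w \<noteq> a \<Longrightarrow> h w = (0::complex)"
  shows "infsum h A = (if a \<in> A then h a else 0)"
proof -
  have "infsum h A = infsum h (A \<inter> {a})"
    by (rule infsum_cong_neutral) (use assms in auto)
  then show ?thesis by auto
qed

lemma annih_apply: "annih i f v = (if i # v \<in> wm_words then f (i # v) else 0)"
  unfolding annih_def wm_extend_def
  by (subst infsum_one_term[where a = "i # v"])
     (auto simp: annih_basis_def tensor_def split: list.splits)

lemma creat_apply:
  assumes "i \<ge> 1"
  shows "creat i f v = (if v \<in> wm_words \<and> v \<noteq> [] \<and> hd v = i then f (tl v) else 0)"
  unfolding creat_def wm_extend_def
  by (subst infsum_one_term[where a = "tl v"]; cases v)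
     (use assms in \<open>auto simp: creat_basis_def tensor_def
        split: list.splits if_splits dest: wm_words_Cons_tl\<close>)

lemma annih_tensor:
  assumes "i \<ge> 1"
  shows "annih i vacuum = (\<lambda>_. 0)"
    and "j # w \<in> wm_words \<Longrightarrow>
      annih i (tensor (j # w)) = (if i = j then tensor w else (\<lambda>_. 0))"
  by (auto simp: annih_apply tensor_def fun_eq_iff)

lemma creat_tensor:
  assumes "i \<ge> 1"
  shows "creat i vacuum = tensor [i]"
    and "j # w \<in> wm_words \<Longrightarrow>
      creat i (tensor (j # w)) = (if i \<ge> j then tensor (i # j # w) else (\<lambda>_. 0))"
proof -
  show "creat i vacuum = tensor [i]"
  proof
    show "creat i vacuum v = tensor [i] v" for v
      using assms by (cases v) (auto simp: creat_apply[OF assms] tensor_def)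
  qed
  show "creat i (tensor (j # w)) = (if i \<ge> j then tensor (i # j # w) else (\<lambda>_. 0))"
    if "j # w \<in> wm_words"
  proof
    show "creat i (tensor (j # w)) v = (if i \<ge> j then tensor (i # j # w) else (\<lambda>_. 0)) v" for v
      using that by (cases v) (auto simp: creat_apply[OF assms] tensor_def)
  qed
qed

lemma fock_diff_tensors:
  assumes "f \<in> fock" "finite S" "S \<subseteq> wm_words"
  shows "(\<lambda>v. f v - (\<Sum>w\<in>S. c w * tensor w v)) \<in> fock"
proof -
  have eq: "(\<Sum>w\<in>S. c w * tensor w v) = (if v \<in> S then c v else 0)" for v
    using assms(2) by (simp add: tensor_def if_distrib cong: if_cong)
  have "(\<lambda>v. (cmod (f v))\<^sup>2) summable_on (UNIV - S)"
    using assms(1) by (auto simp: fock_def intro: summable_on_subset_banach)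
  then have "(\<lambda>v. (cmod (f v - (if v \<in> S then c v else 0)))\<^sup>2) summable_on (UNIV - S)"
    by (rule summable_on_cong[THEN iffD1, rotated]) auto
  then have "(\<lambda>v. (cmod (f v - (if v \<in> S then c v else 0)))\<^sup>2) summable_on ((UNIV - S) \<union> S)"
    using assms(2) by (intro summable_on_Un_disjoint) auto
  moreover have "(UNIV - S) \<union> S = UNIV" by auto
  ultimately show ?thesis
    using assms(1,3) by (auto simp: fock_def eq wm_words_def)
qed

lemma cmod_le_fock_norm:
  assumes "f \<in> fock"
  shows "cmod (f w) \<le> fock_norm f"
proof -
  have "(\<Sum>v\<in>{w}. (cmod (f v))\<^sup>2) \<le> (\<Sum>\<^sub>\<infinity>v. (cmod (f v))\<^sup>2)"
    by (rule finite_sum_le_infsum) (use assms in \<open>auto simp: fock_def\<close>)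
  then show ?thesis
    by (auto simp: fock_norm_def intro: real_le_rsqrt)
qed

lemma wm_fock_iff: "f \<in> wm_fock \<longleftrightarrow> f \<in> fock \<and> (\<forall>w. w \<notin> wm_words \<longrightarrow> f w = 0)"
proof (intro iffI conjI allI impI)
  assume f: "f \<in> wm_fock"
  then show ff: "f \<in> fock" by (simp add: wm_fock_def)
  fix w assume w: "w \<notin> wm_words"
  show "f w = 0"
  proof (rule ccontr)
    assume "f w \<noteq> 0"
    then have "cmod (f w) > 0" by simp
    then obtain S c where S: "finite S" "S \<subseteq> wm_words"
      and lt: "fock_norm (\<lambda>v. f v - (\<Sum>w\<in>S. c w * tensor w v)) < cmod (f w)"
      using f unfolding wm_fock_def mem_Collect_eq by meson
    have "cmod (f w - (\<Sum>u\<in>S. c u * tensor u w)) < cmod (f w)"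
      using cmod_le_fock_norm[OF fock_diff_tensors[OF ff S, of c], of w] lt by simp
    moreover have "(\<Sum>u\<in>S. c u * tensor u w) = 0"
      using S w by (intro sum.neutral) (auto simp: tensor_def)
    ultimately show False by simp
  qed
next
  assume f: "f \<in> fock \<and> (\<forall>w. w \<notin> wm_words \<longrightarrow> f w = 0)"
  let ?g = "\<lambda>w. (cmod (f w))\<^sup>2"
  have sm: "?g summable_on UNIV" using f by (simp add: fock_def)
  show "f \<in> wm_fock"
    unfolding wm_fock_def
  proof (intro CollectI conjI allI impI)
    fix \<epsilon> :: real assume \<epsilon>: "\<epsilon> > 0"
    obtain F where F: "finite F" and d: "dist (sum ?g F) (infsum ?g UNIV) \<le> \<epsilon>\<^sup>2 / 2"
      using infsum_finite_approximation[OF sm, of "\<epsilon>\<^sup>2 / 2"] \<epsilon> by auto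
    define S where "S = F \<inter> wm_words"
    have S: "finite S" "S \<subseteq> wm_words" using F by (auto simp: S_def)
    have eq: "(\<Sum>w\<in>S. f w * tensor w v) = (if v \<in> S then f v else 0)" for v
      using S by (simp add: tensor_def if_distrib cong: if_cong)
    have "(\<Sum>\<^sub>\<infinity>v. (cmod (f v - (\<Sum>w\<in>S. f w * tensor w v)))\<^sup>2) = infsum ?g (UNIV - F)"
      unfolding eq by (rule infsum_cong_neutral) (use f in \<open>auto simp: S_def\<close>)
    also have "\<dots> = infsum ?g UNIV - sum ?g F"
      using sm F by (subst infsum_Diff) auto
    also have "\<dots> \<le> \<epsilon>\<^sup>2 / 2" using d unfolding dist_real_def by linarith
    also have "\<dots> < \<epsilon>\<^sup>2" using \<epsilon> by simp
    finally have "fock_norm (\<lambda>v. f v - (\<Sum>w\<in>S. f w * tensor w v)) < \<epsilon>"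
      using \<epsilon> by (auto simp: fock_norm_def intro: real_less_lsqrt)
    then show "\<exists>S c. finite S \<and> S \<subseteq> wm_words \<and>
        fock_norm (\<lambda>v. f v - (\<Sum>w\<in>S. c w * tensor w v)) < \<epsilon>"
      using S by blast
  qed (use f in auto)
qed

text \<open>Both operators map the weakly monotone Fock space into itself, are contractions, and are
  adjoint to each other.\<close>

lemma wm_shift_inj: "inj_on (Cons i) A"
  by (auto intro: inj_onI)

lemma annih_bounded:
  assumes "f \<in> wm_fock"
  shows "annih i f \<in> wm_fock" and "fock_norm (annih i f) \<le> fock_norm f"
proof -
  let ?g = "\<lambda>w. (cmod (f w))\<^sup>2" and ?h = "\<lambda>w. (cmod (annih i f w))\<^sup>2"
  have sm: "?g summable_on A" for A
    using assms by (auto simp: wm_fock_iff fock_def intro: summable_on_subset_banach)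
  have sm': "(\<lambda>v. ?g (i # v)) summable_on UNIV"
    using summable_on_reindex[OF wm_shift_inj, of ?g i UNIV] sm by (simp add: o_def)
  have le: "?h v \<le> ?g (i # v)" for v by (simp add: annih_apply)
  have smh: "?h summable_on UNIV"
    by (rule summable_on_comparison_test[OF sm']) (use le in auto)
  show "annih i f \<in> wm_fock"
    using smh unfolding wm_fock_iff fock_def
    by (auto simp: annih_apply wm_words_def)
  have "infsum ?h UNIV \<le> (\<Sum>\<^sub>\<infinity>v. ?g (i # v))"
    by (rule infsum_mono[OF smh sm']) (use le in auto)
  also have "\<dots> = infsum ?g (range (Cons i))"
    by (simp add: infsum_reindex[OF wm_shift_inj] o_def)
  also have "\<dots> \<le> infsum ?g UNIV"
    by (rule infsum_mono2) (use sm in auto)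
  finally show "fock_norm (annih i f) \<le> fock_norm f"
    by (simp add: fock_norm_def)
qed

lemma creat_bounded:
  assumes "i \<ge> 1" "f \<in> wm_fock"
  shows "creat i f \<in> wm_fock" and "fock_norm (creat i f) \<le> fock_norm f"
proof -
  let ?g = "\<lambda>w. (cmod (f w))\<^sup>2" and ?h = "\<lambda>w. (cmod (creat i f w))\<^sup>2"
  have sm: "?g summable_on UNIV"
    using assms by (auto simp: wm_fock_iff fock_def)
  have le: "?h (i # v) \<le> ?g v" for v by (simp add: creat_apply[OF assms(1)])
  have zero: "?h w = 0" if "w \<notin> range (Cons i)" for w
    using that by (cases w) (auto simp: creat_apply[OF assms(1)])
  have smr: "(\<lambda>v. ?h (i # v)) summable_on UNIV"
    by (rule summable_on_comparison_test[OF sm]) (use le in auto)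
  then have "?h summable_on range (Cons i)"
    by (subst summable_on_reindex[OF wm_shift_inj]) (simp add: o_def)
  then have smh: "?h summable_on UNIV"
    by (rule summable_on_cong_neutral[THEN iffD1, rotated -1]) (use zero in auto)
  show "creat i f \<in> wm_fock"
    using smh unfolding wm_fock_iff fock_def
    by (auto simp: creat_apply[OF assms(1)] wm_words_def)
  have "infsum ?h UNIV = infsum ?h (range (Cons i))"
    by (rule infsum_cong_neutral) (use zero in auto)
  also have "\<dots> = (\<Sum>\<^sub>\<infinity>v. ?h (i # v))"
    by (simp add: infsum_reindex[OF wm_shift_inj] o_def)
  also have "\<dots> \<le> infsum ?g UNIV"
    by (rule infsum_mono[OF smr sm]) (use le in auto)
  finally show "fock_norm (creat i f) \<le> fock_norm f"
    by (simp add: fock_norm_def)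
qed

lemma annih_creat_adjoint:
  assumes "i \<ge> 1" "f \<in> wm_fock" "g \<in> wm_fock"
  shows "fock_inner (annih i f) g = fock_inner f (creat i g)"
proof -
  have "fock_inner f (creat i g) = (\<Sum>\<^sub>\<infinity>w\<in>range (Cons i). f w * cnj (creat i g w))"
    unfolding fock_inner_def
    by (rule infsum_cong_neutral) (auto simp: creat_apply[OF assms(1)] image_iff neq_Nil_conv)
  also have "\<dots> = (\<Sum>\<^sub>\<infinity>v. f (i # v) * cnj (creat i g (i # v)))"
    by (simp add: infsum_reindex[OF wm_shift_inj] o_def)
  also have "\<dots> = fock_inner (annih i f) g"
    unfolding fock_inner_def
    by (rule infsum_cong) (auto simp: annih_apply creat_apply[OF assms(1)])
  finally show ?thesis by simp
qed

end

theory Submission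
  imports Defs
begin

text \<open>The resolvent of the rescaled operator \<open>T = T\<^sub>m(\<lambda>\<^sub>m)/\<surd>m\<close> can be written down at the vacuum.
Start a sequence at \<open>y\<^sub>0 = y\<close> and let each \<open>y\<^sub>j\<close> arise from its predecessor \<open>p\<close> as
\<open>p + 1/(m p)\<close>. Give the word \<open>w\<close> the coordinate \<open>1/(\<lambda> + y)\<close> times the product over its letters
\<open>i\<close> of \<open>1/(\<surd>m p\<^sub>i)\<close>, where \<open>p\<^sub>i\<close> is the predecessor of \<open>y\<^sub>i\<close>. Because a letter \<open>k\<close> can be put in
front of \<open>w\<close> only if it is at least the first letter of \<open>w\<close>, the sum over all such \<open>k\<close> telescopes,
and this vector \<open>f\<close> satisfies \<open>(z - T) f = \<Omega>\<close> at \<open>z = \<lambda> + y\<^sub>m\<close> (\<open>scaled_T_resolvent_vec\<close>). Hence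
the Stieltjes transform of the vacuum law has the value \<open>1/(\<lambda> + y)\<close> at \<open>\<lambda> + y\<^sub>m\<close>
(\<open>vacuum_law_stieltjes\<close>). The sequence is Euler's scheme with step \<open>1/m\<close> for \<open>y' = 1/y\<close>, so
\<open>y\<^sub>m\<close> tends to \<open>\<surd>(y\<^sup>2 + 2)\<close> (\<open>euler_seq_limit\<close>), and every limit law must have the transform
\<open>1/(\<lambda> + y)\<close> at \<open>\<lambda> + \<surd>(y\<^sup>2 + 2)\<close>.

That transform determines the law. Put \<open>y = 1/t - t/2\<close>, so that \<open>\<surd>(y\<^sup>2 + 2) = 1/t + t/2\<close>. The
generating function in \<open>t\<close> of the orthogonal polynomials \<open>P\<^sub>n\<close> of the free Meixner law is then a
constant plus a multiple of the kernel \<open>1/(z - x)\<close>, and integrating it shows that \<open>P\<^sub>n\<close> has mean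
\<open>0\<close> for \<open>n \<ge> 1\<close> (\<open>meixner_mean_zero\<close>). By the three-term recurrence these means fix all moments
and imply orthogonality (\<open>free_meixner_law_eqI\<close>). The measure with the stated atom and density has
the same transform (\<open>limit_law_stieltjes\<close>): partial fractions reduce this to the integral of
\<open>\<surd>(r\<^sup>2 - u\<^sup>2)/(a - u)\<close>.

What remains is to have the vacuum laws at all, on one compact interval for all \<open>m\<close>. The operator
is symmetric, so its vacuum moments form a positive definite sequence; and the positive vector
with coordinate \<open>m\<close> to the power \<open>-|w|/2\<close> is mapped by \<open>T\<close> below \<open>2 + \<lambda>\<close> times itself, which bounds
the moments by powers of \<open>2 + \<lambda>\<close>. A positive definite sequence with such a bound is the moment
sequence of a measure on \<open>[-2 - \<lambda>, 2 + \<lambda>]\<close> (\<open>bounded_hamburger_moment_problem\<close>), and this measure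
is unique (\<open>real_distribution_eq_moments\<close>). The laws are therefore tight, and their convergence
follows from the uniqueness of the limit points.\<close>

section \<open>Probability measures on a compact interval\<close>

lemma integrable_bounded_support:
  assumes "real_distribution M" "AE x in M. x \<in> {a..b}" "continuous_on {a..b} g"
    "g \<in> borel_measurable borel"
  shows "integrable M (g :: real \<Rightarrow> real)"
proof -
  interpret real_distribution M by fact
  have "bounded (g ` {a..b})"
    by (intro compact_imp_bounded compact_continuous_image assms compact_Icc)
  then obtain B where B: "\<And>x. x \<in> {a..b} \<Longrightarrow> norm (g x) \<le> B"
    unfolding bounded_iff by blast
  show ?thesis
    by (rule integrable_const_bound[of _ B])
       (use assms(4) B in \<open>auto intro!: eventually_mono[OF assms(2)]\<close>)
qed

text \<open>Composing with the retraction of the line onto the interval turns a function that is continuous on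
the interval only into a bounded continuous one, and weak convergence applies to that. Applied to
the distance from the interval, it also gives the support of the limit.\<close>

lemma weak_conv_Icc:
  assumes "\<And>n. real_distribution (\<mu> n)" "real_distribution M" "weak_conv_m \<mu> M"
    and supp: "\<And>n. AE x in \<mu> n. x \<in> {a..b::real}" and ab: "a \<le> b"
  shows weak_conv_Icc_support: "AE x in M. x \<in> {a..b}"
    and weak_conv_Icc_integral: "\<And>g. continuous_on {a..b} g \<Longrightarrow> g \<in> borel_measurable borel \<Longrightarrow>
      (\<lambda>n. LINT x|\<mu> n. g x :: real) \<longlonglongrightarrow> (LINT x|M. g x)"
proof -
  interpret M: real_distribution M by fact
  interpret mu: real_distribution "\<mu> n" for n by fact
  define cl where "cl = (\<lambda>x. max a (min b x))"
  have cl_in: "cl x \<in> {a..b}" for x using ab by (auto simp: cl_def)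
  have cl_id: "cl x = x \<longleftrightarrow> x \<in> {a..b}" for x using ab by (auto simp: cl_def)
  have cl_cont: "continuous_on UNIV cl" unfolding cl_def by (intro continuous_intros)
  let ?h = "\<lambda>x. min 1 \<bar>x - cl x\<bar>"
  have hc: "isCont ?h x" for x
    using cl_cont by (intro continuous_intros) (auto simp: continuous_on_eq_continuous_at)
  have hm [measurable]: "?h \<in> borel_measurable borel"
    using hc by (intro borel_measurable_continuous_onI) (simp add: continuous_at_imp_continuous_on)
  have "(\<lambda>n. integral\<^sup>L (\<mu> n) ?h) \<longlonglongrightarrow> integral\<^sup>L M ?h"
    using assms by (intro weak_conv_imp_integral_bdd_continuous_conv[where B=1] hc) auto
  moreover have "integral\<^sup>L (\<mu> n) ?h = 0" for n
  proof (rule integral_eq_zero_AE, rule eventually_mono[OF supp[of n]])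
    fix x assume "x \<in> {a..b}"
    then have "cl x = x" by (rule cl_id[THEN iffD2])
    then show "?h x = 0" by simp
  qed
  ultimately have h0: "integral\<^sup>L M ?h = 0"
    using LIMSEQ_unique[of "\<lambda>_. 0::real"] by fastforce
  have hi: "integrable M ?h"
    by (rule M.integrable_const_bound[where B=1]) auto
  have "AE x in M. ?h x = 0"
    using h0 by (subst integral_nonneg_eq_0_iff_AE[OF hi, symmetric]) (rule AE_I2, simp, assumption)
  then show sM: "AE x in M. x \<in> {a..b}"
  proof (rule eventually_mono)
    fix x assume "?h x = 0"
    then have "cl x = x" by (simp add: min_def split: if_splits)
    then show "x \<in> {a..b}" by (rule cl_id[THEN iffD1])
  qed
  fix g :: "real \<Rightarrow> real"
  assume g: "continuous_on {a..b} g" and gm [measurable]: "g \<in> borel_measurable borel"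
  have gcl: "continuous_on UNIV (\<lambda>x. g (cl x))"
    by (rule continuous_on_compose2[OF g cl_cont]) (use cl_in in auto)
  have "bounded (g ` {a..b})"
    by (intro compact_imp_bounded compact_continuous_image g compact_Icc)
  then obtain B where B: "\<And>x. x \<in> {a..b} \<Longrightarrow> norm (g x) \<le> B"
    unfolding bounded_iff by blast
  have m [measurable]: "(\<lambda>x. g (cl x)) \<in> borel_measurable borel"
    using gcl by (rule borel_measurable_continuous_onI)
  have "(\<lambda>n. LINT x|\<mu> n. g (cl x)) \<longlonglongrightarrow> (LINT x|M. g (cl x))"
    using gcl cl_in by (intro weak_conv_imp_integral_bdd_continuous_conv[where B=B] B assms)
       (simp_all add: continuous_on_eq_continuous_at)
  moreover have "(LINT x|\<mu> n. g (cl x)) = (LINT x|\<mu> n. g x)" for n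
    by (rule integral_cong_AE) (simp, simp, rule eventually_mono[OF supp[of n]], metis cl_id)
  moreover have "(LINT x|M. g (cl x)) = (LINT x|M. g x)"
    by (rule integral_cong_AE) (simp, simp, rule eventually_mono[OF sM], metis cl_id)
  ultimately show "(\<lambda>n. LINT x|\<mu> n. g x) \<longlonglongrightarrow> (LINT x|M. g x)" by simp
qed

lemma tight_Icc:
  assumes "\<And>n. real_distribution (\<mu> n)" and supp: "\<And>n. AE x in \<mu> n. x \<in> {a..b::real}"
  shows "tight \<mu>"
  unfolding tight_def
proof (intro conjI allI impI assms)
  fix e :: real assume e: "e > 0"
  show "\<exists>c d. c < d \<and> (\<forall>n. 1 - e < measure (\<mu> n) {c<..d})"
  proof (rule exI[of _ "a - 1"], rule exI[of _ "max a b"], intro conjI allI)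
    fix n
    interpret real_distribution "\<mu> n" by fact
    have "measure (\<mu> n) {a-1<..max a b} = 1"
      by (subst prob_eq_1) (simp, rule eventually_mono[OF supp[of n]], simp)
    then show "1 - e < measure (\<mu> n) {a-1<..max a b}" using e by simp
  qed auto
qed

text \<open>Taylor expansion of the characteristic function to order \<open>2n\<close> leaves a remainder controlled by the
moment of order \<open>2n\<close>, which is at most \<open>R\<close> to the power \<open>2n\<close> and loses against the factorial. An
even order makes the absolute moment of \<open>N\<close> one of the given moments, so it suffices to bound the
support of \<open>M\<close>.\<close>

lemma real_distribution_eq_moments:
  assumes "real_distribution M" "real_distribution N"
    and supp: "AE x in M. x \<in> {-R..R}"
    and int: "\<And>n. integrable N (\<lambda>x. x ^ n)"
    and eq: "\<And>n. (LINT x|M. x ^ n) = (LINT x|N. x ^ n)"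
  shows "M = N"
proof -
  interpret M: real_distribution M by fact
  interpret N: real_distribution N by fact
  have intM: "integrable M (\<lambda>x. x ^ n)" for n
    by (rule integrable_bounded_support[OF assms(1) supp]) (auto intro!: continuous_intros)
  have le: "(LINT x|M. \<bar>x\<bar> ^ (2*n)) \<le> R ^ (2*n)" for n
  proof -
    have "(LINT x|M. \<bar>x\<bar> ^ (2*n)) \<le> (LINT x|M. R ^ (2*n))"
    proof (rule integral_mono_AE)
      show "AE x in M. \<bar>x\<bar> ^ (2*n) \<le> R ^ (2*n)"
        using supp by (rule eventually_mono) (auto intro!: power_mono)
    qed (use intM[of "2*n"] in \<open>auto simp: power_even_abs\<close>)
    also have "\<dots> = R ^ (2*n)" by (simp only: lebesgue_integral_const M.prob_space scaleR_one)
    finally show ?thesis .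
  qed
  have leN: "(LINT x|N. \<bar>x\<bar> ^ (2*n)) \<le> R ^ (2*n)" for n
    using le[of n] eq[of "2*n"] by (simp add: power_even_abs)
  have "char M t = char N t" for t
  proof -
    let ?S = "\<lambda>n. \<Sum>k\<le>2*n. ((\<i> * t)^k / fact k) * complex_of_real (LINT x|M. x^k)"
    let ?e = "\<lambda>n. 2 * \<bar>t\<bar>^(2*n) / fact (2*n) * R^(2*n)"
    have d: "cmod (char M t - char N t) \<le> 4 * ((\<bar>t\<bar> * R)^(2*n) / fact (2*n))" for n
    proof -
      have "cmod (char M t - ?S n) \<le> 2 * \<bar>t\<bar>^(2*n) / fact (2*n) * (LINT x|M. \<bar>x\<bar> ^ (2*n))"
        using M.char_approx1[of "2*n" t] intM by simp
      also have "\<dots> \<le> ?e n"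
        using le[of n] by (intro mult_left_mono) auto
      finally have 1: "cmod (char M t - ?S n) \<le> ?e n" .
      have "cmod (char N t - ?S n) \<le> 2 * \<bar>t\<bar>^(2*n) / fact (2*n) * (LINT x|N. \<bar>x\<bar> ^ (2*n))"
        using N.char_approx1[of "2*n" t] int by (simp add: eq)
      also have "\<dots> \<le> ?e n"
        using leN[of n] by (intro mult_left_mono) auto
      finally have 2: "cmod (char N t - ?S n) \<le> ?e n" .
      have "cmod (char M t - char N t) \<le> cmod (char M t - ?S n) + cmod (char N t - ?S n)"
        using norm_triangle_ineq4[of "char M t - ?S n" "char N t - ?S n"] by simp
      with 1 2 show ?thesis by (simp add: power_mult_distrib)
    qed
    have "(\<lambda>n. (\<bar>t\<bar> * R)^n / fact n) \<longlonglongrightarrow> 0"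
      using summable_LIMSEQ_zero[OF summable_exp[of "\<bar>t\<bar> * R"]] by (simp add: divide_inverse mult.commute)
    then have "(\<lambda>n. (\<bar>t\<bar> * R)^(2*n) / fact (2*n)) \<longlonglongrightarrow> 0"
      by (rule LIMSEQ_subseq_LIMSEQ[unfolded o_def]) (simp add: strict_mono_def)
    then have "(\<lambda>n. 4 * ((\<bar>t\<bar> * R)^(2*n) / fact (2*n))) \<longlonglongrightarrow> 0"
      by (rule tendsto_mult_right_zero)
    then have "cmod (char M t - char N t) \<le> 0"
      by (rule LIMSEQ_le_const) (use d in auto)
    then show ?thesis by simp
  qed
  then show ?thesis
    by (intro Levy_uniqueness assms ext)
qed

section \<open>The moment problem on a compact interval\<close>

text \<open>A linear functional on real polynomials. Moment sequences are handled in this form, so that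
algebraic identities between polynomials can be used directly.\<close>

locale poly_functional =
  fixes L :: "real poly \<Rightarrow> real"
  assumes add: "L (p + q) = L p + L q" and smult: "L (smult c p) = c * L p"
begin

lemma zero: "L 0 = 0"
  using smult[of 0 0] by simp

lemma diff: "L (p - q) = L p - L q"
  using add[of p "smult (-1) q"] smult[of "-1" q] by simp

lemma sum: "L (sum f A) = (\<Sum>x\<in>A. L (f x))"
  by (induction A rule: infinite_finite_induct) (simp_all add: zero add)

lemma expand: "L p = (\<Sum>i\<le>degree p. coeff p i * L (monom 1 i))"
proof -
  have "L p = L (\<Sum>i\<le>degree p. monom (coeff p i) i)"
    by (simp add: poly_as_sum_of_monoms)
  also have "\<dots> = (\<Sum>i\<le>degree p. L (smult (coeff p i) (monom 1 i)))"
    by (simp add: sum smult_monom)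
  finally show ?thesis by (simp add: smult)
qed

end

text \<open>The falling factorial \<open>k(k - 1)\<cdots>(k - n + 1)\<close> appears here as \<open>n!\<close> times a binomial coefficient. It
differs from \<open>k\<close> to the power \<open>n\<close> by terms of lower order in \<open>N\<close>, uniformly in \<open>k \<le> N\<close>.\<close>

lemma power_minus_falling_factorial:
  fixes k n N :: nat
  assumes "k \<le> N"
  shows "0 \<le> real k ^ n - fact n * real (k choose n) \<and>
         real N * (real k ^ n - fact n * real (k choose n)) \<le> real n ^ 2 * real N ^ n"
proof (induction n)
  case (Suc n)
  let ?f = "fact n * real (k choose n)" and ?D = "real k ^ n - fact n * real (k choose n)"
  have f: "fact (Suc n) * real (k choose Suc n) = (real k - real n) * ?f"
  proof (cases "n \<le> k")
    case True
    have "Suc n * (k choose Suc n) = (k - n) * (k choose n)"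
      by (metis binomial_absorb_comp binomial_absorption mult.commute)
    then have "real (Suc n) * real (k choose Suc n) = (real k - real n) * real (k choose n)"
      using True by (metis of_nat_diff of_nat_mult)
    then have "fact n * (real (Suc n) * real (k choose Suc n)) = fact n * ((real k - real n) * real (k choose n))"
      by (rule arg_cong)
    then show ?thesis by (simp only: fact_Suc mult_ac of_nat_mult)
  qed (simp add: binomial_eq_0)
  have D: "real k ^ Suc n - fact (Suc n) * real (k choose Suc n) = real k * ?D + real n * ?f"
    unfolding f by (simp add: algebra_simps)
  have fle: "?f \<le> real N ^ n"
    using Suc.IH power_mono[of "real k" "real N" n] assms by simp
  have "real N * (real k * ?D + real n * ?f) = real k * (real N * ?D) + real N * real n * ?f"
    by (simp add: algebra_simps)
  also have "\<dots> \<le> real N * (real n ^ 2 * real N ^ n) + real N * real n * real N ^ n"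
  proof (rule add_mono)
    have "0 \<le> real N * ?D" using Suc.IH by (intro mult_nonneg_nonneg) auto
    then show "real k * (real N * ?D) \<le> real N * (real n ^ 2 * real N ^ n)"
      using Suc.IH assms by (intro mult_mono[of "real k" "real N" "real N * ?D"]) auto
    show "real N * real n * ?f \<le> real N * real n * real N ^ n"
      using fle by (intro mult_left_mono) auto
  qed
  also have "\<dots> = (real n ^ 2 + real n) * real N ^ Suc n"
    by (simp add: algebra_simps)
  also have "\<dots> \<le> real (Suc n) ^ 2 * real N ^ Suc n"
    by (intro mult_right_mono) (auto simp: power2_eq_square algebra_simps)
  finally have 2: "real N * (real k * ?D + real n * ?f) \<le> real (Suc n) ^ 2 * real N ^ Suc n" .
  have 1: "0 \<le> real k * ?D + real n * ?f" using Suc.IH by (intro add_nonneg_nonneg mult_nonneg_nonneg) auto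
  show ?case unfolding D using 1 2 by blast
qed simp

text \<open>Applying \<open>L\<close> to the Bernstein polynomials of degree \<open>N\<close> gives non-negative weights of sum \<open>1\<close>, to be
placed at the points \<open>k/N\<close>. Against these weights, binomial coefficients in \<open>k\<close> have an exact mean,
which comes from the binomial theorem for \<open>x + (1 - x) = 1\<close>; so the moments of the discrete measures
converge to those of \<open>L\<close>, and any weak limit point is the required measure.\<close>

lemma hausdorff_moment_problem:
  fixes L :: "real poly \<Rightarrow> real"
  assumes "poly_functional L" and one: "L 1 = 1"
    and nonneg: "\<And>i j. 0 \<le> L ([:0, 1:] ^ i * [:1, -1:] ^ j)"
  shows "\<exists>M. real_distribution M \<and> (AE x in M. x \<in> {0..1}) \<and> (\<forall>p. (LINT x|M. poly p x) = L p)"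
proof -
  interpret poly_functional L by fact
  let ?X = "[:0, 1:] :: real poly" and ?Y = "[:1, -1:] :: real poly"
  have XY: "?X + ?Y = 1" by (simp add: one_pCons)
  define w where "w N k = real (N choose k) * L (?X ^ k * ?Y ^ (N - k))" for N k
  have w_nonneg: "0 \<le> w N k" for N k by (simp add: w_def nonneg)
  have binom_L: "(\<Sum>j\<le>m. real (m choose j) * L (?X ^ (n + j) * ?Y ^ (m - j))) = L (?X ^ n)" for m n
  proof -
    have "?X ^ n = ?X ^ n * (?X + ?Y) ^ m" by (simp only: XY power_one mult_1_right)
    also have "\<dots> = (\<Sum>j\<le>m. smult (real (m choose j)) (?X ^ (n + j) * ?Y ^ (m - j)))"
      unfolding binomial_ring sum_distrib_left
      by (intro sum.cong refl) (simp add: power_add of_nat_poly mult_ac)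
    finally show ?thesis by (simp add: sum smult)
  qed
  \<comment> \<open>The exact mean of a binomial coefficient: \<open>(N choose k) (k choose n)\<close> equals
    \<open>(N choose n) (N - n choose k - n)\<close>.\<close>
  have w_moment: "(\<Sum>k\<le>N. w N k * real (k choose n)) = real (N choose n) * L (?X ^ n)" for N n
  proof (cases "n \<le> N")
    case True
    have "(\<Sum>k\<le>N. w N k * real (k choose n)) = (\<Sum>k\<in>{n..N}. w N k * real (k choose n))"
      by (rule sum.mono_neutral_right) (auto simp: binomial_eq_0)
    also have "\<dots> = (\<Sum>j\<le>N - n. w N (n + j) * real ((n + j) choose n))"
      by (rule sum.reindex_bij_witness[of _ "\<lambda>j. n + j" "\<lambda>k. k - n"]) (use True in auto)
    also have "\<dots> = (\<Sum>j\<le>N - n. real (N choose n) *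
        (real ((N - n) choose j) * L (?X ^ (n + j) * ?Y ^ (N - n - j))))"
    proof (rule sum.cong[OF refl])
      fix j assume "j \<in> {..N - n}"
      then have "(N choose (n + j)) * ((n + j) choose n) = (N choose n) * ((N - n) choose j)"
        using choose_mult[of n "n + j" N] True by simp
      then have "real (N choose (n + j)) * real ((n + j) choose n) = real (N choose n) * real ((N - n) choose j)"
        by (metis of_nat_mult)
      then show "w N (n + j) * real ((n + j) choose n) =
         real (N choose n) * (real ((N - n) choose j) * L (?X ^ (n + j) * ?Y ^ (N - n - j)))"
        unfolding w_def by (simp add: mult_ac)
    qed
    also have "\<dots> = real (N choose n) * L (?X ^ n)"
      by (simp only: sum_distrib_left[symmetric] binom_L)
    finally show ?thesis .
  qed (simp add: binomial_eq_0)
  have w_sum: "(\<Sum>k\<le>N. w N k) = 1" for N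
    using w_moment[of N 0] one by simp
  define P where "P N = embed_pmf (\<lambda>k. if k \<le> N then w N k else 0)" for N
  have pmfP: "pmf (P N) = (\<lambda>k. if k \<le> N then w N k else 0)" for N
  proof -
    have "(\<integral>\<^sup>+ k. ennreal (if k \<le> N then w N k else 0) \<partial>count_space UNIV)
        = (\<Sum>k\<le>N. ennreal (if k \<le> N then w N k else 0))"
      by (rule nn_integral_count_space') auto
    also have "\<dots> = ennreal (\<Sum>k\<le>N. w N k)"
      by (subst sum_ennreal[symmetric]) (auto simp: w_nonneg)
    finally show ?thesis
      unfolding P_def by (intro ext pmf_embed_pmf) (auto simp: w_nonneg w_sum)
  qed
  have set_P: "set_pmf (P N) \<subseteq> {..N}" for N
    unfolding set_pmf_eq pmfP by auto
  define \<mu> where "\<mu> N = distr (measure_pmf (P (Suc N))) borel (\<lambda>k. real k / real (Suc N))" for N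
  have rd: "real_distribution (\<mu> N)" for N
    unfolding \<mu>_def by (rule prob_space.real_distribution_distr[OF measure_pmf.prob_space_axioms]) simp
  have supp: "AE x in \<mu> N. x \<in> {0..1}" for N
    unfolding \<mu>_def using set_P[of "Suc N"]
    by (subst AE_distr_iff) (auto simp: AE_measure_pmf_iff divide_le_eq)
  have mom: "(LINT x|\<mu> N. x ^ n) = (\<Sum>k\<le>Suc N. w (Suc N) k * (real k / real (Suc N)) ^ n)" for N n
    unfolding \<mu>_def using set_P[of "Suc N"]
    by (subst integral_distr, simp, simp, subst integral_measure_pmf[of "{..Suc N}"])
       (auto simp: pmfP)
  have lim: "(\<lambda>N. LINT x|\<mu> N. x ^ n) \<longlonglongrightarrow> L (?X ^ n)" for n
  proof -
    define c where "c N = fact n * real (N choose n) / real N ^ n" for N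
    have near: "\<bar>(real k / real N) ^ n - fact n * real (k choose n) / real N ^ n\<bar> \<le> real n ^ 2 / real N"
      if "k \<le> N" "N > 0" for k N
    proof -
      have p: "real N > 0" "real N ^ n > 0" using that by auto
      have "(real k / real N) ^ n - fact n * real (k choose n) / real N ^ n =
        (real k ^ n - fact n * real (k choose n)) / real N ^ n" by (simp add: power_divide diff_divide_distrib)
      moreover have "(real k ^ n - fact n * real (k choose n)) / real N ^ n \<le> real n ^ 2 / real N"
        using power_minus_falling_factorial[OF that(1), of n] p by (simp add: field_simps)
      moreover have "0 \<le> (real k ^ n - fact n * real (k choose n)) / real N ^ n"
        using power_minus_falling_factorial[OF that(1), of n] by simp
      ultimately show ?thesis by linarith
    qed
    have z: "(\<lambda>N. real n ^ 2 / real (Suc N)) \<longlonglongrightarrow> 0"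
      by (rule LIMSEQ_Suc[OF lim_const_over_n])
    have c_near: "\<bar>1 - c (Suc N)\<bar> \<le> real n ^ 2 / real (Suc N)" for N
      using near[of "Suc N" "Suc N"] by (simp add: c_def del: of_nat_Suc)
    have "(\<lambda>N. 1 - c (Suc N)) \<longlonglongrightarrow> 0"
      by (rule Lim_null_comparison[OF _ z])
         (rule always_eventually, rule allI, use c_near in simp)
    then have "(\<lambda>N. 1 - (1 - c (Suc N))) \<longlonglongrightarrow> 1 - 0" by (intro tendsto_intros)
    then have c1: "(\<lambda>N. c (Suc N)) \<longlonglongrightarrow> 1" by simp
    have "(\<lambda>N. (LINT x|\<mu> N. x ^ n) - c (Suc N) * L (?X ^ n)) \<longlonglongrightarrow> 0"
    proof (rule Lim_null_comparison[OF _ z], rule always_eventually, rule allI)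
      fix N0
      define N where "N = Suc N0"
      have "c N * L (?X ^ n) = fact n / real N ^ n * (\<Sum>k\<le>N. w N k * real (k choose n))"
        unfolding w_moment c_def by simp
      also have "\<dots> = (\<Sum>k\<le>N. w N k * (fact n * real (k choose n) / real N ^ n))"
        by (simp add: sum_distrib_left field_simps)
      finally have "(LINT x|\<mu> N0. x ^ n) - c N * L (?X ^ n) =
          (\<Sum>k\<le>N. w N k * ((real k / real N) ^ n - fact n * real (k choose n) / real N ^ n))"
        unfolding mom N_def[symmetric] by (simp add: sum_subtractf right_diff_distrib)
      also have "norm \<dots> \<le> (\<Sum>k\<le>N. w N k * (real n ^ 2 / real N))"
      proof (rule sum_norm_le)
        fix k assume "k \<in> {..N}"
        then have "\<bar>(real k / real N) ^ n - fact n * real (k choose n) / real N ^ n\<bar> \<le> real n ^ 2 / real N"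
          by (intro near) (auto simp: N_def)
        then show "norm (w N k * ((real k / real N) ^ n - fact n * real (k choose n) / real N ^ n))
            \<le> w N k * (real n ^ 2 / real N)"
          unfolding real_norm_def abs_mult abs_of_nonneg[OF w_nonneg]
          by (rule mult_left_mono[OF _ w_nonneg])
      qed
      also have "\<dots> = real n ^ 2 / real N"
        by (simp only: sum_distrib_right[symmetric] w_sum mult_1)
      finally show "norm ((LINT x|\<mu> N0. x ^ n) - c (Suc N0) * L (?X ^ n)) \<le> real n ^ 2 / real (Suc N0)"
        unfolding N_def .
    qed
    then have "(\<lambda>N. ((LINT x|\<mu> N. x ^ n) - c (Suc N) * L (?X ^ n)) + c (Suc N) * L (?X ^ n))
        \<longlonglongrightarrow> 0 + 1 * L (?X ^ n)"
      by (intro tendsto_intros c1)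
    then show ?thesis by simp
  qed
  obtain r M where r: "strict_mono (r :: nat \<Rightarrow> nat)" and M: "real_distribution M"
    and wc: "weak_conv_m (\<mu> \<circ> id \<circ> r) M"
    using tight_imp_convergent_subsubsequence[OF tight_Icc[of \<mu> 0 1, OF rd supp] strict_mono_id] by blast
  have rdr: "real_distribution ((\<mu> \<circ> id \<circ> r) n)" and suppr: "AE x in (\<mu> \<circ> id \<circ> r) n. x \<in> {0..1}" for n
    by (simp_all only: o_def id_def rd supp)
  have sM: "AE x in M. x \<in> {0..1}"
    by (rule weak_conv_Icc_support[OF rdr M wc suppr]) simp
  have momM: "(LINT x|M. x ^ n) = L (?X ^ n)" for n
  proof (rule LIMSEQ_unique)
    show "(\<lambda>k. LINT x|(\<mu> \<circ> id \<circ> r) k. x ^ n) \<longlonglongrightarrow> (LINT x|M. x ^ n)"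
      by (rule weak_conv_Icc_integral[OF rdr M wc suppr]) (auto intro!: continuous_intros)
    show "(\<lambda>k. LINT x|(\<mu> \<circ> id \<circ> r) k. x ^ n) \<longlonglongrightarrow> L (?X ^ n)"
      using LIMSEQ_subseq_LIMSEQ[OF lim[of n] r] by (simp add: o_def)
  qed
  have int: "integrable M (\<lambda>x. x ^ n)" for n
    by (rule integrable_bounded_support[OF M sM]) (auto intro!: continuous_intros)
  have "(LINT x|M. poly p x) = L p" for p
  proof -
    have "(LINT x|M. poly p x) = (\<Sum>i\<le>degree p. coeff p i * (LINT x|M. x ^ i))"
      unfolding poly_altdef using int by (subst Bochner_Integration.integral_sum) auto
    also have "\<dots> = L p"
      by (simp only: expand[of p] momM monom_altdef smult_1_left)
    finally show ?thesis .
  qed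
  with M sM show ?thesis by blast
qed

lemma quadratic_nonneg_discriminant:
  fixes a b d :: real
  assumes "\<And>t. 0 \<le> a + 2 * t * b + t\<^sup>2 * d" "d \<ge> 0"
  shows "b\<^sup>2 \<le> a * d"
proof (cases "d = 0")
  case True
  have "b = 0"
  proof (rule ccontr)
    assume "b \<noteq> 0"
    then have "a + 2 * (- (a + 1) / (2 * b)) * b = - 1" by (simp add: field_simps)
    then show False using assms(1)[of "-(a + 1) / (2 * b)"] True by simp
  qed
  then show ?thesis using True by simp
next
  case False
  then show ?thesis using assms(1)[of "- b / d"] assms(2)
    by (simp add: field_simps power2_eq_square)
qed

text \<open>The Cauchy-Schwarz inequality propagates along powers of two: a ratio \<open>r = |c 1| / c 0\<close> larger than
\<open>R\<close> would force \<open>c\<close> to grow at least like powers of \<open>r\<close>.\<close>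

lemma log_convex_growth:
  fixes c :: "nat \<Rightarrow> real"
  assumes cs: "\<And>i j. (c (i + j))\<^sup>2 \<le> c (2 * i) * c (2 * j)"
    and growth: "\<And>k. \<bar>c k\<bar> \<le> C * R ^ k" and R: "R > 0" and c0: "c 0 \<ge> 0"
  shows "\<bar>c 1\<bar> \<le> R * c 0"
proof (cases "c 0 = 0")
  case True
  then show ?thesis using cs[of 0 1] by simp
next
  case False
  with c0 have p: "c 0 > 0" by simp
  show ?thesis
  proof (rule ccontr)
    assume n: "\<not> \<bar>c 1\<bar> \<le> R * c 0"
    define r where "r = \<bar>c 1\<bar> / c 0"
    have rR: "r > R" using n p by (simp add: r_def field_simps)
    have low: "c 0 * r ^ (2 ^ Suc k) \<le> c (2 ^ Suc k)" for k
    proof (induction k)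
      case 0
      have "c 0 * (c 0 * r\<^sup>2) = (c 1)\<^sup>2" using p by (simp add: r_def power2_eq_square field_simps)
      also have "\<dots> \<le> c 0 * c 2" using cs[of 0 1] by simp
      finally show ?case using p by simp
    next
      case (Suc k)
      let ?n = "2 ^ Suc k :: nat"
      have "c 0 * (c 0 * r ^ (2 * ?n)) = (c 0 * r ^ ?n)\<^sup>2"
        unfolding mult_2 power_add by (simp add: power2_eq_square mult_ac del: power_Suc)
      also have "\<dots> \<le> (c ?n)\<^sup>2"
        using Suc p rR R by (intro power_mono) auto
      also have "\<dots> \<le> c 0 * c (2 * ?n)" using cs[of 0 ?n] by simp
      finally have "c 0 * r ^ (2 * ?n) \<le> c (2 * ?n)" using p by simp
      then show ?case by simp
    qed
    obtain k where k: "C / c 0 < (r / R) ^ k"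
      using real_arch_pow[of "r / R"] rR R by auto
    have "(r / R) ^ k \<le> (r / R) ^ (2 ^ Suc k)"
    proof (rule power_increasing)
      show "k \<le> 2 ^ Suc k" using less_exp[of k] unfolding power_Suc by linarith
    qed (use rR R in simp)
    also have "\<dots> \<le> C / c 0"
    proof -
      have "c 0 * r ^ (2 ^ Suc k) \<le> C * R ^ (2 ^ Suc k)"
        using low[of k] growth[of "2 ^ Suc k"] by linarith
      then show ?thesis using p R by (simp add: power_divide field_simps)
    qed
    finally show False using k by simp
  qed
qed

text \<open>The growth bound says that multiplication by \<open>x\<close> has norm at most \<open>R\<close> with respect to the form
\<open>L(pq)\<close>, so \<open>L\<close> is non-negative on \<open>(R + x) p\<^sup>2\<close> and \<open>(R - x) p\<^sup>2\<close>. From these two follows positivity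
on all products of powers of \<open>R + x\<close> and \<open>R - x\<close>, and after an affine change of variable the
moment problem on \<open>[0, 1]\<close> applies.\<close>

lemma bounded_hamburger_moment_problem:
  fixes L :: "real poly \<Rightarrow> real"
  assumes "poly_functional L" and one: "L 1 = 1" and sq: "\<And>p. 0 \<le> L (p * p)"
    and growth: "\<And>n. \<bar>L (monom 1 n)\<bar> \<le> R ^ n" and R: "R > 0"
  shows "\<exists>M. real_distribution M \<and> (AE x in M. x \<in> {-R..R}) \<and> (\<forall>p. (LINT x|M. poly p x) = L p)"
proof -
  interpret poly_functional L by fact
  let ?X = "[:0, 1:] :: real poly"
  have Xn: "monom 1 n = ?X ^ n" for n by (simp add: monom_altdef)
  have bound: "\<bar>L (?X * (p * p))\<bar> \<le> R * L (p * p)" for p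
  proof -
    define q where "q = p * p"
    define c where "c k = L (?X ^ k * q)" for k
    define C where "C = (\<Sum>i\<le>degree q. \<bar>coeff q i\<bar> * R ^ i)"
    have cc: "c (2 * j) \<ge> 0" for j
    proof -
      have "?X ^ (2 * j) * q = (?X ^ j * p) * (?X ^ j * p)"
        unfolding q_def mult_2[of j] power_add by (simp only: mult_ac)
      then show ?thesis unfolding c_def using sq by simp
    qed
    have "\<bar>c 1\<bar> \<le> R * c 0"
    proof (rule log_convex_growth)
      fix i j
      show "(c (i + j))\<^sup>2 \<le> c (2 * i) * c (2 * j)"
      proof (rule quadratic_nonneg_discriminant[OF _ cc])
        fix t :: real
        let ?u = "(?X ^ i + smult t (?X ^ j)) * p"
        have "?u * ?u = (?X ^ i * ?X ^ i) * q + smult (2 * t) (?X ^ i * ?X ^ j * q)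
            + smult (t\<^sup>2) (?X ^ j * ?X ^ j * q)"
          by (rule poly_ext) (simp add: q_def, algebra)
        then have "?u * ?u = ?X ^ (2 * i) * q + smult (2 * t) (?X ^ (i + j) * q) + smult (t\<^sup>2) (?X ^ (2 * j) * q)"
          by (simp only: mult_2 power_add)
        then have "L (?u * ?u) = c (2 * i) + 2 * t * c (i + j) + t\<^sup>2 * c (2 * j)"
          by (simp only: add smult c_def)
        then show "0 \<le> c (2 * i) + 2 * t * c (i + j) + t\<^sup>2 * c (2 * j)" using sq[of ?u] by simp
      qed
    next
      fix k
      have "?X ^ k * q = (\<Sum>i\<le>degree q. smult (coeff q i) (monom 1 (k + i)))"
        by (subst poly_as_sum_of_monoms[of q, symmetric])
           (simp add: sum_distrib_left Xn[symmetric] mult_monom smult_monom)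
      then have "\<bar>c k\<bar> = \<bar>\<Sum>i\<le>degree q. coeff q i * L (monom 1 (k + i))\<bar>"
        unfolding c_def by (simp add: sum smult)
      also have "\<dots> \<le> (\<Sum>i\<le>degree q. \<bar>coeff q i\<bar> * R ^ (k + i))"
        by (rule order_trans[OF sum_abs], rule sum_mono) (simp add: abs_mult mult_left_mono growth)
      also have "\<dots> = C * R ^ k"
        unfolding C_def sum_distrib_right by (simp add: power_add mult_ac)
      finally show "\<bar>c k\<bar> \<le> C * R ^ k" .
    qed (use R cc[of 0] in auto)
    then show ?thesis by (simp add: c_def q_def)
  qed
  let ?A = "[:R, 1:]" and ?B = "[:R, -1:]"
  have A: "?A * q = smult R q + ?X * q" and B: "?B * q = smult R q - ?X * q" for q
    by (simp_all add: algebra_simps)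
  have Apos: "0 \<le> L (?A * (p * p))" and Bpos: "0 \<le> L (?B * (p * p))" for p
    using bound[of p] unfolding A B add smult diff by linarith+
  have ABpos: "0 \<le> L (?A * (?B * (p * p)))" for p
  proof -
    \<comment> \<open>The sum of the factors \<open>R + x\<close> and \<open>R - x\<close> is the constant \<open>2 R\<close>.\<close>
    have "smult (2 * R) (?A * (?B * (p * p))) =
        ?A * ((?B * p) * (?B * p)) + ?B * ((?A * p) * (?A * p))"
      by (rule poly_ext) (simp add: algebra_simps)
    then have "2 * R * L (?A * (?B * (p * p))) \<ge> 0"
      using Apos[of "?B * p"] Bpos[of "?A * p"] by (metis smult add add_nonneg_nonneg)
    then show ?thesis using R by (simp add: zero_le_mult_iff)
  qed
  have pos: "0 \<le> L (?A ^ i * ?B ^ j)" for i j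
  proof -
    define p where "p = ?A ^ (i div 2) * ?B ^ (j div 2)"
    have i: "?A ^ i = ?A ^ (i mod 2) * (?A ^ (i div 2) * ?A ^ (i div 2))"
      by (metis mod_mult_div_eq mult_2 power_add)
    have j: "?B ^ j = ?B ^ (j mod 2) * (?B ^ (j div 2) * ?B ^ (j div 2))"
      by (metis mod_mult_div_eq mult_2 power_add)
    have eq: "?A ^ i * ?B ^ j = ?A ^ (i mod 2) * (?B ^ (j mod 2) * (p * p))"
      unfolding p_def by (subst i, subst j) (simp only: mult_ac)
    have "i mod 2 = 0 \<or> i mod 2 = 1" "j mod 2 = 0 \<or> j mod 2 = 1" by auto
    then show ?thesis unfolding eq using sq[of p] Apos[of p] Bpos[of p] ABpos[of p]
      by (elim disjE) simp_all
  qed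
  define L' where "L' q = L (q \<circ>\<^sub>p [:1/2, 1/(2*R):])" for q
  have "\<exists>M. real_distribution M \<and> (AE x in M. x \<in> {0..1}) \<and> (\<forall>p. (LINT x|M. poly p x) = L' p)"
  proof (rule hausdorff_moment_problem)
    show "poly_functional L'"
      by unfold_locales (simp_all add: L'_def pcompose_add pcompose_smult add smult)
    show "L' 1 = 1" by (simp add: L'_def one pcompose_1)
    fix i j
    have "([:0, 1:] ^ i * [:1, -1:] ^ j) \<circ>\<^sub>p [:1/2, 1/(2*R):] =
        smult ((1/(2*R)) ^ i * (1/(2*R)) ^ j) (?A ^ i * ?B ^ j)"
      (is "?l = ?r")
    proof (rule poly_ext)
      fix x
      have "1/2 + x / (2 * R) = 1/(2*R) * (R + x)" "1/2 - x / (2 * R) = 1/(2*R) * (R - x)"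
        using R by (simp_all add: field_simps)
      then have "(1/2 + x / (2 * R)) ^ i * (1/2 - x / (2 * R)) ^ j =
          (1/(2*R)) ^ i * (1/(2*R)) ^ j * ((R + x) ^ i * (R - x) ^ j)"
        by (simp only: power_mult_distrib mult_ac)
      then show "poly ?l x = poly ?r x" by (simp add: poly_pcompose)
    qed
    then have "L' ([:0, 1:] ^ i * [:1, -1:] ^ j) = (1/(2*R)) ^ i * (1/(2*R)) ^ j * L (?A ^ i * ?B ^ j)"
      unfolding L'_def by (simp only: smult)
    then show "0 \<le> L' ([:0, 1:] ^ i * [:1, -1:] ^ j)"
      using pos[of i j] R by simp
  qed
  then obtain M where M: "real_distribution M" "AE x in M. x \<in> {0..1}"
    and LM: "\<And>p. (LINT x|M. poly p x) = L' p" by blast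
  interpret M: real_distribution M by fact
  define N where "N = distr M borel (\<lambda>y. 2 * R * y - R)"
  have "real_distribution N" unfolding N_def by (rule M.real_distribution_distr) simp
  moreover have "AE x in N. x \<in> {-R..R}"
    unfolding N_def
  proof (subst AE_distr_iff)
    show "AE y in M. 2 * R * y - R \<in> {- R..R}"
      by (rule eventually_mono[OF M(2)]) (use R in auto)
  qed auto
  moreover have "(LINT x|N. poly p x) = L p" for p
  proof -
    have "(LINT x|N. poly p x) = (LINT y|M. poly p (2 * R * y - R))"
      unfolding N_def
      by (rule integral_distr) (auto intro!: borel_measurable_continuous_onI continuous_intros)
    also have "\<dots> = (LINT y|M. poly (p \<circ>\<^sub>p [:-R, 2*R:]) y)"
      by (simp add: poly_pcompose algebra_simps)
    also have "\<dots> = L p"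
      unfolding LM L'_def using R
      by (simp add: pcompose_assoc[symmetric] pcompose_pCons)
    finally show ?thesis .
  qed
  ultimately show ?thesis by blast
qed

section \<open>The operators in real coordinates\<close>

definition words_upto :: "nat \<Rightarrow> nat list set" where
  "words_upto m = {w \<in> wm_words. set w \<subseteq> {..m}}"

lemma words_upto_Nil [simp]: "[] \<in> words_upto m"
  by (simp add: words_upto_def)

lemma words_upto_single [simp]: "[k] \<in> words_upto m \<longleftrightarrow> k \<in> {1..m}"
  by (auto simp: words_upto_def)

lemma words_upto_Cons_Cons [simp]:
  "k # i # v \<in> words_upto m \<longleftrightarrow> i \<le> k \<and> k \<le> m \<and> i # v \<in> words_upto m"
  by (auto simp: words_upto_def)

lemma words_upto_ConsD: "k # v \<in> words_upto m \<Longrightarrow> k \<in> {1..m} \<and> v \<in> words_upto m"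
  by (auto simp: words_upto_def wm_words_def)

lemma words_upto_iff_hd:
  "w \<in> wm_words \<and> w \<noteq> [] \<and> hd w \<le> m \<longleftrightarrow> w \<in> words_upto m \<and> w \<noteq> []"
  by (cases w) (auto simp: words_upto_def wm_words_def)

lemma finite_words_upto_length: "finite {w \<in> words_upto m. length w \<le> N}"
  by (rule finite_subset[OF _ finite_lists_length_le[of "{..m}" N]]) (auto simp: words_upto_def)

text \<open>The operator \<open>T\<^sub>m(lam \<surd>m)/\<surd>m\<close> on real coordinate functions. The coordinate at \<open>w\<close> collects a
creation (from \<open>tl w\<close>), the annihilations (from all words \<open>k # w\<close>), and the number operators, which
together act as the identity on all words except the empty one.\<close>

definition scaled_T :: "nat \<Rightarrow> real \<Rightarrow> (nat list \<Rightarrow> real) \<Rightarrow> nat list \<Rightarrow> real" where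
  "scaled_T m lam g w = (if w \<in> words_upto m then
     ((if w = [] then 0 else g (tl w)) + (\<Sum>k=1..m. if k # w \<in> words_upto m then g (k # w) else 0)) / sqrt m
     + (if w = [] then 0 else lam * g w) else 0)"

lemma T_op_of_real:
  assumes m: "m \<ge> 1" and supp: "\<And>w. w \<notin> words_upto m \<Longrightarrow> g w = 0"
  shows "(\<lambda>w. T_op m (lam * sqrt (real m)) (\<lambda>v. complex_of_real (g v)) w / complex_of_real (sqrt (real m)))
    = (\<lambda>w. complex_of_real (scaled_T m lam g w))"
proof
  fix w
  let ?f = "\<lambda>v. complex_of_real (g v)" and ?s = "sqrt (real m)"
  have an: "annih k ?f w = complex_of_real (if k # w \<in> words_upto m then g (k # w) else 0)"
    for k using supp[of "k # w"] by (auto simp: annih_apply words_upto_def)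
  have cr: "creat k ?f w = (if w \<in> wm_words \<and> w \<noteq> [] \<and> hd w = k then ?f (tl w) else 0)"
    and nu: "number_op k ?f w = (if w \<in> wm_words \<and> w \<noteq> [] \<and> hd w = k then ?f w else 0)"
    if "k \<in> {1..m}" for k
    using that by (auto simp: number_op_def creat_apply annih_apply)
  have hd1: "hd w \<ge> 1" if "w \<in> wm_words" "w \<noteq> []"
    using that by (cases w) (auto simp: wm_words_def)
  have cr_sum: "(\<Sum>k=1..m. creat k ?f w + complex_of_real (lam * ?s) * number_op k ?f w)
      = (if w \<in> words_upto m \<and> w \<noteq> [] then ?f (tl w) + complex_of_real (lam * ?s) * ?f w else 0)"
  proof -
    have "(\<Sum>k=1..m. creat k ?f w + complex_of_real (lam * ?s) * number_op k ?f w)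
        = (\<Sum>k=1..m. if k = hd w then (if w \<in> wm_words \<and> w \<noteq> []
            then ?f (tl w) + complex_of_real (lam * ?s) * ?f w else 0) else 0)"
      by (rule sum.cong[OF refl]) (auto simp: cr nu)
    also have "\<dots> = (if w \<in> words_upto m \<and> w \<noteq> [] then ?f (tl w) + complex_of_real (lam * ?s) * ?f w else 0)"
      using words_upto_iff_hd[of w m] hd1 by (auto simp: sum.delta')
    finally show ?thesis .
  qed
  have "T_op m (lam * ?s) ?f w = (\<Sum>k=1..m. annih k ?f w)
      + (\<Sum>k=1..m. creat k ?f w + complex_of_real (lam * ?s) * number_op k ?f w)"
    unfolding T_op_def gaussian_op_def by (simp add: sum.distrib add.assoc)
  also have "\<dots> = complex_of_real ((\<Sum>k=1..m. if k # w \<in> words_upto m then g (k # w) else 0)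
      + (if w \<in> words_upto m \<and> w \<noteq> [] then g (tl w) + lam * ?s * g w else 0))"
    unfolding cr_sum an by simp
  also have "\<dots> / complex_of_real ?s = complex_of_real (scaled_T m lam g w)"
  proof (cases "w \<in> words_upto m")
    case True
    then have "((\<Sum>k=1..m. if k # w \<in> words_upto m then g (k # w) else 0)
      + (if w \<in> words_upto m \<and> w \<noteq> [] then g (tl w) + lam * ?s * g w else 0)) / ?s = scaled_T m lam g w"
      using m unfolding scaled_T_def by (simp add: add_divide_distrib)
    then show ?thesis by (simp only: of_real_divide[symmetric])
  next
    case False
    then have "k # w \<notin> words_upto m" for k using words_upto_ConsD by blast
    with False show ?thesis by (simp add: scaled_T_def)
  qed
  finally show "T_op m (lam * ?s) ?f w / complex_of_real ?s = complex_of_real (scaled_T m lam g w)" .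
qed

definition vac_orbit :: "nat \<Rightarrow> real \<Rightarrow> nat \<Rightarrow> nat list \<Rightarrow> real" where
  "vac_orbit m lam n = (scaled_T m lam ^^ n) (\<lambda>w. if w = [] then 1 else 0)"

lemma vac_orbit_0: "vac_orbit m lam 0 w = (if w = [] then 1 else 0)"
  by (simp add: vac_orbit_def)

lemma vac_orbit_Suc: "vac_orbit m lam (Suc n) = scaled_T m lam (vac_orbit m lam n)"
  by (simp add: vac_orbit_def)

lemma vac_orbit_support:
  "w \<notin> {w \<in> words_upto m. length w \<le> n} \<Longrightarrow> vac_orbit m lam n w = 0"
proof (induction n arbitrary: w)
  case (Suc n)
  show ?case
  proof (cases "w \<in> words_upto m")
    case True
    with Suc.prems have l: "length w > Suc n" by simp
    then have "vac_orbit m lam n (tl w) = 0" "vac_orbit m lam n w = 0" "vac_orbit m lam n (k # w) = 0" for k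
      by (auto intro!: Suc.IH)
    then show ?thesis by (simp add: vac_orbit_Suc scaled_T_def cong: if_cong)
  qed (simp add: vac_orbit_Suc scaled_T_def)
qed (auto simp: vac_orbit_0)

lemma vac_orbit_nonneg: "lam \<ge> 0 \<Longrightarrow> vac_orbit m lam n w \<ge> 0"
  by (induction n arbitrary: w)
     (auto simp: vac_orbit_0 vac_orbit_Suc scaled_T_def intro!: add_nonneg_nonneg divide_nonneg_nonneg sum_nonneg)

lemma T_op_iterate_vacuum:
  assumes "m \<ge> 1"
  shows "((\<lambda>f w. T_op m (lam * sqrt (real m)) f w / complex_of_real (sqrt (real m))) ^^ n) vacuum
    = (\<lambda>w. complex_of_real (vac_orbit m lam n w))"
proof (induction n)
  case 0
  show ?case by (auto simp: vac_orbit_0 tensor_def)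
next
  case (Suc n)
  show ?case
    unfolding funpow.simps(2) o_apply Suc.IH vac_orbit_Suc
    by (rule T_op_of_real[OF assms]) (simp add: vac_orbit_support)
qed

lemma fock_inner_vacuum: "fock_inner f vacuum = f []"
  unfolding fock_inner_def by (subst infsum_one_term[where a = "[]"]) (auto simp: tensor_def)


section \<open>Symmetry and growth\<close>

definition pairing :: "nat \<Rightarrow> nat \<Rightarrow> (nat list \<Rightarrow> real) \<Rightarrow> (nat list \<Rightarrow> real) \<Rightarrow> real" where
  "pairing m N g u = (\<Sum>w\<in>{w \<in> words_upto m. length w \<le> N}. g w * u w)"

text \<open>Prepending a letter is a bijection from pairs onto the non-empty words; words that become too long
are the ones on which \<open>H\<close> vanishes.\<close>

lemma sum_words_upto_Cons:
  fixes H :: "nat list \<Rightarrow> real"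
  assumes "\<And>v. length v > N \<Longrightarrow> H v = 0"
  shows "(\<Sum>w\<in>{w \<in> words_upto m. length w \<le> N}. \<Sum>k=1..m. if k # w \<in> words_upto m then H (k # w) else 0)
    = (\<Sum>v\<in>{w \<in> words_upto m. length w \<le> N}. if v = [] then 0 else H v)"
proof -
  let ?W = "{w \<in> words_upto m. length w \<le> N}"
  have fin: "finite ?W" by (rule finite_words_upto_length)
  have "(\<Sum>w\<in>?W. \<Sum>k=1..m. if k # w \<in> words_upto m then H (k # w) else 0)
     = (\<Sum>(w, k)\<in>?W \<times> {1..m}. if k # w \<in> words_upto m then H (k # w) else 0)"
    by (rule sum.cartesian_product)
  also have "\<dots> = (\<Sum>(w, k)\<in>{(w, k). k # w \<in> ?W}. H (k # w))"
  proof (rule sum.mono_neutral_cong_right)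
    show "finite (?W \<times> {1..m})" using fin by simp
    show "{(w, k). k # w \<in> ?W} \<subseteq> ?W \<times> {1..m}" by (auto dest: words_upto_ConsD)
    show "\<forall>x\<in>?W \<times> {1..m} - {(w, k). k # w \<in> ?W}.
        (case x of (w, k) \<Rightarrow> if k # w \<in> words_upto m then H (k # w) else 0) = 0"
    proof
      fix x assume x: "x \<in> ?W \<times> {1..m} - {(w, k). k # w \<in> ?W}"
      obtain w k where [simp]: "x = (w, k)" by (cases x)
      show "(case x of (w, k) \<Rightarrow> if k # w \<in> words_upto m then H (k # w) else 0) = 0"
        using x assms[of "k # w"] by (cases "k # w \<in> words_upto m") (simp_all add: not_le)
    qed
  qed auto
  also have "\<dots> = (\<Sum>v\<in>?W - {[]}. H v)"
    by (rule sum.reindex_bij_witness[of _ "\<lambda>v. (tl v, hd v)" "\<lambda>(w, k). k # w"]) auto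
  also have "\<dots> = (\<Sum>v\<in>?W. if v = [] then 0 else H v)"
    using fin by (intro sum.mono_neutral_cong_left) auto
  finally show ?thesis .
qed

text \<open>Creation is the transpose of annihilation. The pairing is truncated at length \<open>N\<close>, so the vector \<open>u\<close>
must leave room for one more letter, while \<open>g\<close> may be any function of words.\<close>

lemma scaled_T_symmetric:
  assumes supp: "\<And>w. w \<notin> {w \<in> words_upto m. length w \<le> n} \<Longrightarrow> u w = 0" and n: "n < N"
  shows "pairing m N g (scaled_T m lam u) = pairing m N (scaled_T m lam g) u"
proof -
  let ?W = "{w \<in> words_upto m. length w \<le> N}"
  let ?up = "\<lambda>a b. \<Sum>w\<in>?W. a w * (if w = [] then 0 else b (tl w))"
  let ?dn = "\<lambda>a b. \<Sum>w\<in>?W. a w * (\<Sum>k=1..m. if k # w \<in> words_upto m then b (k # w) else 0)"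
  have dn: "?dn a b = (\<Sum>w\<in>?W. \<Sum>k=1..m. if k # w \<in> words_upto m then a w * b (k # w) else 0)"
    for a b :: "nat list \<Rightarrow> real"
    unfolding sum_distrib_left by (intro sum.cong refl) simp
  have up: "?up b a = (\<Sum>v\<in>?W. if v = [] then 0 else a (tl v) * b v)"
    for a b :: "nat list \<Rightarrow> real"
    by (intro sum.cong refl) simp
  have supp_tl: "u (tl v) = 0" "u v = 0" if "length v > N" for v
    using that n by (auto intro!: supp)
  have 1: "?dn g u = ?up u g"
    unfolding dn up using n
    by (subst sum_words_upto_Cons[symmetric]) (auto simp: supp_tl cong: if_cong)
  have 2: "?dn u g = ?up g u"
    unfolding dn up using n
    by (subst sum_words_upto_Cons[symmetric]) (auto simp: supp_tl cong: if_cong)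
  have expand: "pairing m N a (scaled_T m lam b) =
      (?up a b + ?dn a b) / sqrt m + (\<Sum>w\<in>?W. if w = [] then 0 else lam * (a w * b w))" for a b
  proof -
    have "pairing m N a (scaled_T m lam b) =
      (\<Sum>w\<in>?W. (a w * (if w = [] then 0 else b (tl w))
         + a w * (\<Sum>k=1..m. if k # w \<in> words_upto m then b (k # w) else 0)) / sqrt m
         + (if w = [] then 0 else lam * (a w * b w)))"
      unfolding pairing_def scaled_T_def by (intro sum.cong refl) (simp add: algebra_simps add_divide_distrib)
    then show ?thesis by (simp only: sum.distrib sum_divide_distrib[symmetric])
  qed
  have "pairing m N g (scaled_T m lam u) = pairing m N u (scaled_T m lam g)"
    unfolding expand 1 2 by (simp add: mult.commute add.commute cong: if_cong)
  then show ?thesis by (simp add: pairing_def mult.commute)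
qed

lemma pairing_vac_orbit_Suc:
  assumes "n < N"
  shows "pairing m N g (vac_orbit m lam (Suc n)) = pairing m N (scaled_T m lam g) (vac_orbit m lam n)"
  unfolding vac_orbit_Suc by (rule scaled_T_symmetric[OF vac_orbit_support assms])

lemma pairing_vac_orbit_0: "pairing m N g (vac_orbit m lam 0) = g []"
  unfolding pairing_def vac_orbit_0
  by (simp add: if_distrib sum.delta finite_words_upto_length cong: if_cong)

lemma vac_orbit_gram:
  assumes "j \<le> N"
  shows "pairing m N (vac_orbit m lam i) (vac_orbit m lam j) = vac_orbit m lam (i + j) []"
  using assms
proof (induction j arbitrary: i)
  case (Suc j)
  then show ?case
    using Suc.IH[of "Suc i"] by (simp add: pairing_vac_orbit_Suc vac_orbit_Suc[symmetric])
qed (simp add: pairing_vac_orbit_0)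

text \<open>Schur's test. Creation replaces the weight of \<open>w\<close> by \<open>\<surd>m\<close> times itself, annihilation sums at most
\<open>m\<close> weights that are smaller by \<open>\<surd>m\<close>; after division by \<open>\<surd>m\<close> each of them contributes at most
the weight itself.\<close>

lemma scaled_T_weight:
  assumes m: "m \<ge> 1" and lam: "lam \<ge> 0"
  defines "g \<equiv> (\<lambda>w. (1 / sqrt m) ^ length (w :: nat list))"
  shows "scaled_T m lam g w \<le> (2 + lam) * g w"
proof (cases "w \<in> words_upto m")
  case True
  have s: "sqrt m > 0" "sqrt m * sqrt m = m" using m by simp_all
  have gpos: "g v > 0" for v using s by (simp add: g_def)
  have "(\<Sum>k=1..m. if k # w \<in> words_upto m then g (k # w) else 0) \<le> (\<Sum>k=1..m. g w / sqrt m)"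
    by (rule sum_mono) (use s in \<open>auto simp: g_def\<close>)
  also have "\<dots> = sqrt m * g w" using s by (simp add: field_simps)
  finally have d: "(\<Sum>k=1..m. if k # w \<in> words_upto m then g (k # w) else 0) / sqrt m \<le> g w"
    using s by (simp add: field_simps)
  have u: "(if w = [] then 0 else g (tl w)) / sqrt m \<le> g w"
    using gpos[of w] s by (cases w) (auto simp: g_def)
  have l: "(if w = [] then 0 else lam * g w) \<le> lam * g w" using lam gpos[of w] by (auto intro: mult_nonneg_nonneg less_imp_le)
  show ?thesis
    using d u l True by (simp add: scaled_T_def add_divide_distrib algebra_simps)
next
  case False
  then show ?thesis using lam by (simp add: scaled_T_def g_def)
qed

lemma pairing_mono_left:
  assumes "\<And>w. w \<in> words_upto m \<Longrightarrow> g w \<le> h w" "\<And>w. 0 \<le> u w"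
  shows "pairing m N g u \<le> pairing m N h u"
  unfolding pairing_def using assms by (intro sum_mono mult_right_mono) auto

lemma pairing_scale_left: "pairing m N (\<lambda>w. c * g w) u = c * pairing m N g u"
  by (simp add: pairing_def sum_distrib_left mult.assoc)

lemma weight_vac_orbit_le:
  assumes "m \<ge> 1" "lam \<ge> 0" "n \<le> N"
  shows "pairing m N (\<lambda>w. (1 / sqrt m) ^ length w) (vac_orbit m lam n) \<le> (2 + lam) ^ n"
  using assms(3)
proof (induction n)
  case (Suc n)
  let ?g = "\<lambda>w :: nat list. (1 / sqrt m) ^ length w"
  have "pairing m N ?g (vac_orbit m lam (Suc n)) = pairing m N (scaled_T m lam ?g) (vac_orbit m lam n)"
    using Suc.prems by (simp add: pairing_vac_orbit_Suc)
  also have "\<dots> \<le> pairing m N (\<lambda>w. (2 + lam) * ?g w) (vac_orbit m lam n)"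
    using scaled_T_weight[OF assms(1,2)] vac_orbit_nonneg[OF assms(2)] by (intro pairing_mono_left) auto
  also have "\<dots> \<le> (2 + lam) * (2 + lam) ^ n"
    unfolding pairing_scale_left using Suc assms(2) by (intro mult_left_mono) auto
  finally show ?case by simp
qed (simp add: pairing_vac_orbit_0)

lemma vacuum_moment_bound:
  assumes "m \<ge> 1" "lam \<ge> 0"
  shows "0 \<le> vac_orbit m lam n []" "vac_orbit m lam n [] \<le> (2 + lam) ^ n"
proof -
  let ?g = "\<lambda>w :: nat list. (1 / sqrt m) ^ length w"
  show "0 \<le> vac_orbit m lam n []" by (rule vac_orbit_nonneg[OF assms(2)])
  have "(\<Sum>w\<in>{[]}. ?g w * vac_orbit m lam n w) \<le> pairing m n ?g (vac_orbit m lam n)"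
    unfolding pairing_def using vac_orbit_nonneg[OF assms(2)]
    by (intro sum_mono2 finite_words_upto_length) auto
  also have "\<dots> \<le> (2 + lam) ^ n" by (rule weight_vac_orbit_le[OF assms]) simp
  finally show "vac_orbit m lam n [] \<le> (2 + lam) ^ n" by simp
qed


section \<open>Existence of the vacuum laws\<close>

lemma poly_functional_of_moments:
  "poly_functional (\<lambda>p. \<Sum>i\<le>degree p. coeff p i * c i)"
proof
  fix p q :: "real poly" and a :: real
  let ?L = "\<lambda>p. \<Sum>i\<le>degree p. coeff p i * c i"
  have ext: "?L r = (\<Sum>i\<le>n. coeff r i * c i)" if "degree r \<le> n" for r n
    using that by (intro sum.mono_neutral_left) (auto simp: coeff_eq_0)
  have "?L (p + q) = (\<Sum>i\<le>max (degree p) (degree q). coeff (p + q) i * c i)"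
    by (rule ext) (simp add: degree_add_le_max)
  also have "\<dots> = ?L p + ?L q"
    by (simp add: ext[of p "max (degree p) (degree q)"] ext[of q "max (degree p) (degree q)"]
        distrib_right sum.distrib)
  finally show "?L (p + q) = ?L p + ?L q" .
  have "?L (smult a p) = (\<Sum>i\<le>degree p. coeff (smult a p) i * c i)"
    by (rule ext) (rule degree_smult_le)
  then show "?L (smult a p) = a * ?L p" by (simp add: sum_distrib_left mult.assoc)
qed

text \<open>Writing \<open>v\<^sub>i\<close> for \<open>vac_orbit m lam i\<close>, the value of the moment functional at \<open>p\<^sup>2\<close> is the squared norm
of the vector \<open>\<Sum> p\<^sub>i v\<^sub>i\<close>, by symmetry of the operator.\<close>

lemma vacuum_moment_measure:
  assumes m: "m \<ge> 1" and lam: "lam \<ge> 0"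
  shows "\<exists>M. real_distribution M \<and> (AE x in M. x \<in> {-(2 + lam)..2 + lam}) \<and>
    (\<forall>n. (LINT x|M. x ^ n) = vac_orbit m lam n [])"
proof -
  define c where "c n = vac_orbit m lam n []" for n
  define L where "L p = (\<Sum>i\<le>degree p. coeff p i * c i)" for p
  interpret poly_functional L unfolding L_def by (rule poly_functional_of_moments)
  have Lmon: "L (monom a n) = a * c n" for a n
  proof (cases "a = 0")
    case False
    then show ?thesis
      by (simp add: L_def degree_monom_eq if_distrib[of "\<lambda>x. x * _"] sum.delta cong: if_cong)
  qed (simp add: zero)
  have "\<exists>M. real_distribution M \<and> (AE x in M. x \<in> {-(2 + lam)..2 + lam}) \<and> (\<forall>p. (LINT x|M. poly p x) = L p)"
  proof (rule bounded_hamburger_moment_problem)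
    show "poly_functional L" by unfold_locales
    show "L 1 = 1" using Lmon[of 1 0] by (simp add: c_def vac_orbit_0)
    show "0 \<le> L (p * p)" for p
    proof -
      let ?d = "degree p" and ?W = "{w \<in> words_upto m. length w \<le> degree p}"
      have "p * p = (\<Sum>i\<le>?d. \<Sum>j\<le>?d. monom (coeff p i * coeff p j) (i + j))"
        by (subst (1 2) poly_as_sum_of_monoms[of p, symmetric]) (simp add: sum_product mult_monom)
      then have "L (p * p) = (\<Sum>i\<le>?d. \<Sum>j\<le>?d. coeff p i * coeff p j * c (i + j))"
        by (simp add: sum Lmon)
      also have "\<dots> = (\<Sum>i\<le>?d. \<Sum>j\<le>?d. \<Sum>w\<in>?W. (coeff p i * vac_orbit m lam i w) * (coeff p j * vac_orbit m lam j w))"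
        unfolding c_def
        by (intro sum.cong refl, subst vac_orbit_gram[of _ ?d, symmetric])
           (auto simp: pairing_def sum_distrib_left mult_ac)
      also have "\<dots> = (\<Sum>w\<in>?W. (\<Sum>i\<le>?d. coeff p i * vac_orbit m lam i w)\<^sup>2)"
        unfolding power2_eq_square sum_product
        by (subst sum.swap, subst (2) sum.swap) (rule refl)
      also have "\<dots> \<ge> 0" by (rule sum_nonneg) simp
      finally show ?thesis .
    qed
    show "\<bar>L (monom 1 n)\<bar> \<le> (2 + lam) ^ n" for n
      using vacuum_moment_bound[OF m lam, of n] by (simp add: Lmon c_def)
  qed (use lam in simp)
  then obtain M where M: "real_distribution M" "AE x in M. x \<in> {-(2 + lam)..2 + lam}"
    "\<And>p. (LINT x|M. poly p x) = L p" by blast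
  have "(LINT x|M. x ^ n) = vac_orbit m lam n []" for n
    using M(3)[of "monom 1 n"] by (simp add: Lmon c_def poly_monom)
  with M show ?thesis by blast
qed

lemma vacuum_law_scaled_T:
  assumes m: "m \<ge> 1" and lam: "lam \<ge> 0"
  defines "\<mu> \<equiv> vacuum_law (\<lambda>f w. T_op m (lam * sqrt (real m)) f w / complex_of_real (sqrt (real m)))"
  shows "real_distribution \<mu>" "AE x in \<mu>. x \<in> {-(2 + lam)..2 + lam}"
    "(LINT x|\<mu>. x ^ n) = vac_orbit m lam n []"
proof -
  obtain M where M: "real_distribution M" "AE x in M. x \<in> {-(2 + lam)..2 + lam}"
    "\<And>n. (LINT x|M. x ^ n) = vac_orbit m lam n []"
    using vacuum_moment_measure[OF m lam] by blast
  have "\<mu> = M"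
    unfolding \<mu>_def vacuum_law_def T_op_iterate_vacuum[OF m] fock_inner_vacuum of_real_eq_iff
  proof (rule the_equality)
    have "integrable M (\<lambda>x. x ^ n)" for n
      by (rule integrable_bounded_support[OF M(1,2)]) (auto intro!: continuous_intros)
    with M show "real_distribution M \<and> (\<forall>n. integrable M (\<lambda>x. x ^ n) \<and>
        (LINT x|M. x ^ n) = vac_orbit m lam n [])" by blast
    fix N assume "real_distribution N \<and> (\<forall>n. integrable N (\<lambda>x. x ^ n) \<and>
        (LINT x|N. x ^ n) = vac_orbit m lam n [])"
    then show "N = M"
      using real_distribution_eq_moments[OF M(1) _ M(2), of N] M(3) by simp
  qed
  with M show "real_distribution \<mu>" "AE x in \<mu>. x \<in> {-(2 + lam)..2 + lam}"
    "(LINT x|\<mu>. x ^ n) = vac_orbit m lam n []" by (simp_all only:)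
qed

section \<open>The Stieltjes transforms of the vacuum laws\<close>

text \<open>Euler's scheme with step \<open>1/m\<close> for the equation \<open>y' = 1/y\<close>, whose solution after time \<open>1\<close> is
\<open>\<surd>(y\<^sup>2 + 2)\<close>.\<close>

primrec euler_seq :: "nat \<Rightarrow> real \<Rightarrow> nat \<Rightarrow> real" where
  "euler_seq m y 0 = y"
| "euler_seq m y (Suc j) = euler_seq m y j + 1 / (real m * euler_seq m y j)"

lemma euler_seq_ge: "y > 0 \<Longrightarrow> y \<le> euler_seq m y j"
proof (induction j)
  case (Suc j)
  then have "0 \<le> 1 / (real m * euler_seq m y j)" by simp
  with Suc show ?case unfolding euler_seq.simps by linarith
qed simp

text \<open>Squaring the recursion adds exactly \<open>2/m\<close> in each step, up to a term of order \<open>1/m\<^sup>2\<close>.\<close>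

lemma euler_seq_square:
  assumes m: "m \<ge> 1" and y: "y > 0"
  shows "y\<^sup>2 + 2 * real j / real m \<le> (euler_seq m y j)\<^sup>2 \<and>
    (euler_seq m y j)\<^sup>2 \<le> y\<^sup>2 + 2 * real j / real m + real j / (real m * y)\<^sup>2"
proof (induction j)
  case (Suc j)
  let ?e = "euler_seq m y j"
  have e: "?e \<ge> y" "?e > 0" using euler_seq_ge[OF y, of m j] y by auto
  have sq: "(euler_seq m y (Suc j))\<^sup>2 = ?e\<^sup>2 + 2 / real m + 1 / (real m * ?e)\<^sup>2"
    using e m by (simp add: power2_eq_square field_simps)
  have "1 / (real m * ?e)\<^sup>2 \<le> 1 / (real m * y)\<^sup>2"
    using e y m by (intro divide_left_mono power_mono mult_left_mono) auto
  moreover have "0 \<le> 1 / (real m * ?e)\<^sup>2" by simp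
  moreover have "2 * real (Suc j) / real m = 2 * real j / real m + 2 / real m"
    "real (Suc j) / (real m * y)\<^sup>2 = real j / (real m * y)\<^sup>2 + 1 / (real m * y)\<^sup>2"
    by (simp_all add: add_divide_distrib)
  ultimately show ?case using Suc.IH unfolding sq by linarith
qed simp

lemma euler_seq_limit:
  assumes y: "y > 0"
  shows "(\<lambda>n. euler_seq (Suc n) y (Suc n)) \<longlonglongrightarrow> sqrt (y\<^sup>2 + 2)"
proof (rule tendsto_sandwich[OF always_eventually always_eventually tendsto_const])
  have b: "y\<^sup>2 + 2 \<le> (euler_seq (Suc n) y (Suc n))\<^sup>2 \<and>
    (euler_seq (Suc n) y (Suc n))\<^sup>2 \<le> y\<^sup>2 + 2 + 1 / y\<^sup>2 / real (Suc n)" for n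
    using euler_seq_square[OF _ y, of "Suc n" "Suc n"]
    by (simp add: power_mult_distrib power2_eq_square mult_ac del: euler_seq.simps of_nat_Suc)
  have pos: "euler_seq (Suc n) y (Suc n) \<ge> 0" for n
    using euler_seq_ge[OF y, of "Suc n" "Suc n"] y by linarith
  show "\<forall>n. sqrt (y\<^sup>2 + 2) \<le> euler_seq (Suc n) y (Suc n)"
    using b pos real_le_lsqrt by (metis real_sqrt_le_mono real_sqrt_abs abs_of_nonneg)
  show "\<forall>n. euler_seq (Suc n) y (Suc n) \<le> sqrt (y\<^sup>2 + 2 + 1 / y\<^sup>2 / real (Suc n))"
    using b pos by (metis real_sqrt_le_mono real_sqrt_abs abs_of_nonneg)
  have "(\<lambda>n. 1 / y\<^sup>2 / real (Suc n)) \<longlonglongrightarrow> 0"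
    by (rule LIMSEQ_Suc[OF lim_const_over_n])
  then have "(\<lambda>n. sqrt (y\<^sup>2 + 2 + 1 / y\<^sup>2 / real (Suc n))) \<longlonglongrightarrow> sqrt (y\<^sup>2 + 2 + 0)"
    by (intro tendsto_intros)
  then show "(\<lambda>n. sqrt (y\<^sup>2 + 2 + 1 / y\<^sup>2 / real (Suc n))) \<longlonglongrightarrow> sqrt (y\<^sup>2 + 2)" by simp
qed

lemma euler_seq_telescope:
  assumes "i \<in> {1..m}"
  shows "(\<Sum>k=i..m. 1 / (real M * euler_seq M y (k - 1))) = euler_seq M y m - euler_seq M y (i - 1)"
proof -
  obtain i' where i: "i = Suc i'" using assms by (cases i) auto
  have "i' \<le> m" using assms i by simp
  then show ?thesis unfolding i
    by (induction m rule: dec_induct) (simp_all add: sum.cl_ivl_Suc)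
qed

text \<open>A letter \<open>i \<ge> 1\<close> contributes a factor built from the value before the step \<open>i\<close> of the scheme, hence
the index \<open>i - 1\<close>.\<close>

definition resolvent_vec :: "nat \<Rightarrow> real \<Rightarrow> real \<Rightarrow> nat list \<Rightarrow> real" where
  "resolvent_vec m lam y w = (\<Prod>i\<leftarrow>w. 1 / (sqrt m * euler_seq m y (i - 1))) / (lam + y)"

text \<open>The resolvent equation. At a word with first letter \<open>i\<close>, creation contributes the factor
\<open>euler_seq m y (i - 1)\<close> by definition, and the annihilations contribute the telescoping sum
\<open>euler_seq m y m - euler_seq m y (i - 1)\<close>, so that \<open>i\<close> cancels. At the empty word there is no
creation term, and exactly \<open>1\<close> is missing.\<close>

lemma scaled_T_resolvent_vec:
  assumes m: "m \<ge> 1" and lam: "lam \<ge> 0" and y: "y > 0" and w: "w \<in> words_upto m"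
  shows "scaled_T m lam (resolvent_vec m lam y) w =
    (lam + euler_seq m y m) * resolvent_vec m lam y w - (if w = [] then 1 else 0)"
proof -
  let ?e = "euler_seq m y" and ?f = "resolvent_vec m lam y" and ?s = "sqrt (real m)"
  have s: "?s > 0" "?s * ?s = real m" using m by simp_all
  have e: "?e k > 0" for k using euler_seq_ge[OF y, of m k] y by linarith
  have cons: "?f (k # v) = ?f v / (?s * ?e (k - 1))" for k v
    by (simp add: resolvent_vec_def)
  have cs: "?f (k # v) / ?s = ?f v * (1 / (real m * ?e (k - 1)))" for k v
  proof -
    have "?s * ?e (k - 1) * ?s = real m * ?e (k - 1)" using s(2) by (simp add: mult_ac)
    then show ?thesis unfolding cons by (metis divide_divide_eq_left times_divide_eq_right mult_1_right)
  qed
  show ?thesis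
  proof (cases w)
    case Nil
    have "(\<Sum>k=1..m. if [k] \<in> words_upto m then ?f [k] else 0) / ?s = (\<Sum>k=1..m. ?f [k] / ?s)"
      unfolding sum_divide_distrib by (intro sum.cong) auto
    also have "\<dots> = ?f [] * (?e m - y)"
      unfolding cs sum_distrib_left[symmetric] using euler_seq_telescope[of 1 m m y] m by simp
    also have "\<dots> = (lam + ?e m) * ?f [] - 1"
      using lam y by (simp add: resolvent_vec_def field_simps)
    finally show ?thesis by (simp add: Nil scaled_T_def)
  next
    case (Cons i v)
    have i: "i \<in> {1..m}" using w words_upto_ConsD unfolding Cons by blast
    have "(\<Sum>k=1..m. if k # w \<in> words_upto m then ?f (k # w) else 0) / ?s = (\<Sum>k=i..m. ?f (k # w) / ?s)"
      unfolding sum_divide_distrib using w i unfolding Cons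
      by (intro sum.mono_neutral_cong_right) auto
    also have "\<dots> = ?f w * (?e m - ?e (i - 1))"
      unfolding cs sum_distrib_left[symmetric] euler_seq_telescope[OF i] ..
    finally have d: "(\<Sum>k=1..m. if k # w \<in> words_upto m then ?f (k # w) else 0) / ?s
        = ?f w * (?e m - ?e (i - 1))" .
    have u: "?f (tl w) / ?s = ?f w * ?e (i - 1)"
      using s(1) e[of "i - 1"] by (simp add: Cons cons)
    have "w \<noteq> []" using Cons by simp
    then show ?thesis
      using w d u by (simp add: scaled_T_def add_divide_distrib algebra_simps)
  qed
qed

text \<open>For \<open>y \<ge> 1\<close> every factor is at most \<open>1/\<surd>m\<close>. So the weight of Schur's test dominates the resolvent
vector, and pairings of the latter with the orbit of the vacuum inherit the bound from that test.\<close>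

lemma resolvent_vec_bounds:
  assumes m: "m \<ge> 1" and lam: "lam \<ge> 0" and y: "y \<ge> 1"
  shows "0 \<le> resolvent_vec m lam y w"
    "resolvent_vec m lam y w \<le> 1 / (lam + y) * (1 / sqrt m) ^ length w"
proof -
  let ?h = "\<lambda>i. 1 / (sqrt m * euler_seq m y (i - 1))"
  have e: "euler_seq m y k \<ge> 1" for k using euler_seq_ge[of y m k] y by linarith
  have h: "0 \<le> ?h i" "?h i \<le> 1 / sqrt m" for i
  proof -
    show "0 \<le> ?h i" using e[of "i - 1"] by simp
    have "sqrt m * 1 \<le> sqrt m * euler_seq m y (i - 1)" using e by (intro mult_left_mono) auto
    then show "?h i \<le> 1 / sqrt m" using m by (intro divide_left_mono) auto
  qed
  have p: "0 \<le> (\<Prod>i\<leftarrow>w. ?h i) \<and> (\<Prod>i\<leftarrow>w. ?h i) \<le> (1 / sqrt m) ^ length w"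
  proof (induction w)
    case (Cons i w)
    have "?h i * (\<Prod>i\<leftarrow>w. ?h i) \<le> 1 / sqrt m * (1 / sqrt m) ^ length w"
      using Cons h[of i] by (intro mult_mono) auto
    moreover have "0 \<le> ?h i * (\<Prod>i\<leftarrow>w. ?h i)"
      using Cons h[of i] by (intro mult_nonneg_nonneg) auto
    ultimately show ?case unfolding list.map prod_list.Cons length_Cons power_Suc by blast
  qed simp
  then show "0 \<le> resolvent_vec m lam y w" using lam y by (simp add: resolvent_vec_def)
  show "resolvent_vec m lam y w \<le> 1 / (lam + y) * (1 / sqrt m) ^ length w"
    unfolding resolvent_vec_def using p lam y by (simp add: divide_right_mono)
qed

text \<open>Pairing the resolvent equation with the orbit of the vacuum gives a linear recursion, hence the
partial sums of the moment series up to a remainder \<open>\<langle>f, T\<^sup>N \<Omega>\<rangle> / z\<^sup>N\<close>. The remainder lies between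
\<open>0\<close> and a constant times the \<open>N\<close>-th power of \<open>(2 + lam)/z\<close>, and \<open>z > 2 + lam\<close>.\<close>

lemma vacuum_moment_series:
  assumes m: "m \<ge> 1" and lam: "lam \<ge> 0" and y: "y > 2"
  defines "z \<equiv> lam + euler_seq m y m"
  shows "(\<lambda>N. \<Sum>n<N. vac_orbit m lam n [] / z ^ Suc n) \<longlonglongrightarrow> 1 / (lam + y)"
proof -
  let ?f = "resolvent_vec m lam y"
  have "euler_seq m y m > 2" using euler_seq_ge[of y m m] y by linarith
  then have z: "z > 2 + lam" by (simp add: z_def)
  have z0: "z > 0" using z lam by simp
  have telescope: "?f [] - (\<Sum>n<k. vac_orbit m lam n [] / z ^ Suc n) = pairing m N ?f (vac_orbit m lam k) / z ^ k"
    if "k \<le> N" for k N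
    using that
  proof (induction k)
    case (Suc k)
    let ?u = "vac_orbit m lam k"
    have "pairing m N ?f (vac_orbit m lam (Suc k)) = pairing m N (scaled_T m lam ?f) ?u"
      using Suc.prems by (intro pairing_vac_orbit_Suc) simp
    also have "\<dots> = (\<Sum>w\<in>{w \<in> words_upto m. length w \<le> N}. z * (?f w * ?u w) - (if w = [] then ?u [] else 0))"
      unfolding pairing_def
      by (rule sum.cong[OF refl])
         (use y in \<open>auto simp: scaled_T_resolvent_vec[OF m lam] z_def algebra_simps\<close>)
    also have "\<dots> = z * pairing m N ?f ?u - ?u []"
      by (simp add: sum_subtractf pairing_def sum_distrib_left sum.delta finite_words_upto_length)
    finally show ?case using Suc z0 by (simp add: field_simps)
  qed (simp add: pairing_vac_orbit_0)
  have bound: "\<bar>1 / (lam + y) - (\<Sum>n<N. vac_orbit m lam n [] / z ^ Suc n)\<bar>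
      \<le> 1 / (lam + y) * ((2 + lam) / z) ^ N" for N
  proof -
    let ?p = "pairing m N ?f (vac_orbit m lam N)"
    have "0 \<le> ?p"
      unfolding pairing_def using resolvent_vec_bounds[OF m lam] vac_orbit_nonneg[OF lam] y
      by (intro sum_nonneg mult_nonneg_nonneg) auto
    moreover have "?p \<le> 1 / (lam + y) * (2 + lam) ^ N"
    proof -
      have "?p \<le> pairing m N (\<lambda>w. 1 / (lam + y) * (1 / sqrt m) ^ length w) (vac_orbit m lam N)"
        using resolvent_vec_bounds(2)[OF m lam] vac_orbit_nonneg[OF lam] y
        by (intro pairing_mono_left) auto
      also have "\<dots> \<le> 1 / (lam + y) * (2 + lam) ^ N"
        unfolding pairing_scale_left using weight_vac_orbit_le[OF m lam, of N N] lam y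
        by (intro mult_left_mono) auto
      finally show ?thesis .
    qed
    moreover have "?f [] = 1 / (lam + y)" by (simp add: resolvent_vec_def)
    ultimately have "0 \<le> ?p / z ^ N" "?p / z ^ N \<le> 1 / (lam + y) * (2 + lam) ^ N / z ^ N"
      "1 / (lam + y) - (\<Sum>n<N. vac_orbit m lam n [] / z ^ Suc n) = ?p / z ^ N"
      using telescope[of N N] z0 by (simp, intro divide_right_mono, simp_all)
    then show ?thesis by (simp add: power_divide)
  qed
  have "(\<lambda>N. 1 / (lam + y) * ((2 + lam) / z) ^ N) \<longlonglongrightarrow> 0"
    using z lam by (intro tendsto_mult_right_zero LIMSEQ_power_zero) auto
  then have "(\<lambda>N. 1 / (lam + y) - (\<Sum>n<N. vac_orbit m lam n [] / z ^ Suc n)) \<longlonglongrightarrow> 0"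
    by (rule Lim_null_comparison[rotated]) (rule always_eventually, use bound in simp)
  then have "(\<lambda>N. 1 / (lam + y) - (1 / (lam + y) - (\<Sum>n<N. vac_orbit m lam n [] / z ^ Suc n)))
      \<longlonglongrightarrow> 1 / (lam + y) - 0"
    by (intro tendsto_intros)
  then show ?thesis by simp
qed

lemma stieltjes_continuous_on:
  "R < z \<Longrightarrow> continuous_on {-R..R} (\<lambda>x. 1 / (z - x :: real))"
  by (intro continuous_intros) auto

lemma stieltjes_moment_series:
  assumes M: "real_distribution M" and supp: "AE x in M. x \<in> {-R..R}" and z: "R < z" and R: "R > 0"
  shows "(\<lambda>N. \<Sum>n<N. (LINT x|M. x ^ n) / z ^ Suc n) \<longlonglongrightarrow> (LINT x|M. 1 / (z - x))"
proof -
  interpret real_distribution M by fact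
  have int: "integrable M (\<lambda>x. x ^ n)" for n
    by (rule integrable_bounded_support[OF M supp]) (auto intro!: continuous_intros)
  have ints: "integrable M (\<lambda>x. 1 / (z - x))"
    by (rule integrable_bounded_support[OF M supp stieltjes_continuous_on[OF z]]) simp
  have bound: "norm ((\<Sum>n<N. (LINT x|M. x ^ n) / z ^ Suc n) - (LINT x|M. 1 / (z - x))) \<le> (R / z) ^ N / (z - R)" for N
  proof -
    let ?d = "\<lambda>x. (\<Sum>n<N. x ^ n / z ^ Suc n) - 1 / (z - x)"
    have "(\<Sum>n<N. (LINT x|M. x ^ n) / z ^ Suc n) - (LINT x|M. 1 / (z - x)) = (LINT x|M. ?d x)"
      using int ints by simp
    also have "norm \<dots> \<le> (LINT x|M. norm (?d x))" by (rule integral_norm_bound)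
    also have "\<dots> \<le> (LINT x|M. (R / z) ^ N / (z - R))"
    proof (rule integral_mono_AE)
      show "integrable M (\<lambda>x. norm (?d x))" using int ints by simp
      show "AE x in M. norm (?d x) \<le> (R / z) ^ N / (z - R)"
      proof (rule eventually_mono[OF supp])
        fix x assume x: "x \<in> {-R..R}"
        have ne: "z - x > 0" "z > 0" using x z R by auto
        have "(\<Sum>n<N. x ^ n / z ^ Suc n) = (\<Sum>n<N. (x / z) ^ n) / z"
          by (simp add: sum_divide_distrib power_divide mult.commute)
        also have "\<dots> = (1 - (x / z) ^ N) / (z - x)"
          using ne by (subst sum_gp_strict) (auto simp: field_simps)
        finally have "?d x = - ((x / z) ^ N / (z - x))" by (simp add: diff_divide_distrib)
        then have "norm (?d x) = (\<bar>x\<bar> / z) ^ N / (z - x)"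
          using ne by (simp add: abs_mult power_abs abs_divide)
        also have "\<dots> \<le> (R / z) ^ N / (z - R)"
          using x ne z R by (intro frac_le power_mono divide_right_mono) auto
        finally show "norm (?d x) \<le> (R / z) ^ N / (z - R)" .
      qed
    qed simp
    also have "\<dots> = (R / z) ^ N / (z - R)"
      by (simp only: lebesgue_integral_const prob_space scaleR_one)
    finally show ?thesis .
  qed
  have "(\<lambda>N. (R / z) ^ N / (z - R)) \<longlonglongrightarrow> 0"
    using z R by (intro tendsto_divide_zero LIMSEQ_power_zero) auto
  then have "(\<lambda>N. (\<Sum>n<N. (LINT x|M. x ^ n) / z ^ Suc n) - (LINT x|M. 1 / (z - x))) \<longlonglongrightarrow> 0"
    by (rule Lim_null_comparison[OF always_eventually, rotated]) (rule allI, rule bound)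
  then show ?thesis by (rule LIM_zero_cancel)
qed

lemma vacuum_law_stieltjes:
  assumes m: "m \<ge> 1" and lam: "lam \<ge> 0" and y: "y > 2"
  shows "(LINT x|vacuum_law (\<lambda>f w. T_op m (lam * sqrt (real m)) f w / complex_of_real (sqrt (real m))).
      1 / (lam + euler_seq m y m - x)) = 1 / (lam + y)"
proof -
  have z: "2 + lam < lam + euler_seq m y m" using euler_seq_ge[of y m m] y by linarith
  show ?thesis
  proof (rule LIMSEQ_unique)
    show "(\<lambda>N. \<Sum>n<N. vac_orbit m lam n [] / (lam + euler_seq m y m) ^ Suc n) \<longlonglongrightarrow> 1 / (lam + y)"
      by (rule vacuum_moment_series[OF m lam y])
    show "(\<lambda>N. \<Sum>n<N. vac_orbit m lam n [] / (lam + euler_seq m y m) ^ Suc n) \<longlonglongrightarrow>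
      (LINT x|vacuum_law (\<lambda>f w. T_op m (lam * sqrt (real m)) f w / complex_of_real (sqrt (real m))).
        1 / (lam + euler_seq m y m - x))"
      using stieltjes_moment_series[OF vacuum_law_scaled_T(1,2)[OF m lam] z] lam
      unfolding vacuum_law_scaled_T(3)[OF m lam] by simp
  qed
qed

section \<open>Free Meixner laws and their orthogonal polynomials\<close>

lemma integrable_poly_bounded_support:
  assumes "real_distribution M" "AE x in M. x \<in> {-R..R}"
  shows "integrable M (poly p :: real \<Rightarrow> real)"
  by (rule integrable_bounded_support[OF assms])
     (auto intro!: continuous_intros borel_measurable_continuous_onI)

lemma meixner_poly_rec:
  "n \<ge> 1 \<Longrightarrow> meixner_poly a b c \<alpha> (Suc n) =
     [:-a, 1:] * meixner_poly a b c \<alpha> n - smult b (meixner_poly a b c \<alpha> (n - 1))"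
  by (cases n) simp_all

lemma meixner_poly_degree:
  "degree (meixner_poly a b c \<alpha> n) \<le> n \<and> (n \<ge> 1 \<longrightarrow> coeff (meixner_poly a b c \<alpha> n) n = 1)"
proof (induction n rule: less_induct)
  case (less n)
  consider "n = 0" | "n = 1" | k where "n = Suc (Suc k)"
    by (metis One_nat_def not0_implies_Suc)
  then show ?case
  proof cases
    case 3
    let ?P = "meixner_poly a b c \<alpha>"
    have 1: "degree (?P (Suc k)) \<le> Suc k" "coeff (?P (Suc k)) (Suc k) = 1" "degree (?P k) \<le> k"
      using less.IH[of "Suc k"] less.IH[of k] 3 by auto
    have "degree ([:-a, 1:] * ?P (Suc k)) \<le> n"
      using degree_mult_le[of "[:-a, 1:]" "?P (Suc k)"] 1 3 by simp
    moreover have "degree (smult b (?P k)) \<le> n"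
      using degree_smult_le[of b "?P k"] 1 3 by simp
    moreover have "coeff ([:-a, 1:] * ?P (Suc k)) n = 1" "coeff (?P k) n = 0"
      using 1 3 by (auto simp: coeff_eq_0)
    ultimately show ?thesis using 3 by (auto intro: degree_diff_le)
  qed auto
qed

text \<open>The argument of Favard's theorem: by the recurrence, \<open>x\<^sup>k\<^sup>+\<^sup>1 P\<^sub>n\<close> is a combination of \<open>x\<^sup>k P\<^sub>j\<close> with
\<open>j \<ge> n - 1\<close>, so the mean of \<open>x\<^sup>k P\<^sub>n\<close> vanishes for \<open>k < n\<close> as soon as all \<open>P\<^sub>n\<close> with \<open>n \<ge> 1\<close> have
mean \<open>0\<close>. The recurrence holds from \<open>n = 1\<close> on, and \<open>n > k + 1\<close> in each step.\<close>

lemma meixner_orthogonal: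
  assumes M: "real_distribution M" "AE x in M. x \<in> {-R..R}"
    and mean0: "\<And>n. n \<ge> 1 \<Longrightarrow> (LINT x|M. poly (meixner_poly a b c \<alpha> n) x) = 0"
    and mn: "m \<noteq> n"
  shows "(LINT x|M. poly (meixner_poly a b c \<alpha> m) x * poly (meixner_poly a b c \<alpha> n) x) = 0"
proof -
  let ?P = "meixner_poly a b c \<alpha>"
  have int: "integrable M (poly p)" for p by (rule integrable_poly_bounded_support[OF M])
  have monom_mult: "poly (monom r k * p) = (\<lambda>x. r * x ^ k * poly p x)" for r k and p :: "real poly"
    by (rule ext) (simp add: poly_monom)
  have power: "(LINT x|M. x ^ k * poly (?P n) x) = 0" if "k < n" for k n
    using that
  proof (induction k arbitrary: n)
    case (Suc k)
    then have n: "n \<ge> 1" by simp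
    have intk: "integrable M (\<lambda>x. x ^ k * poly p x)" for p
      using int[of "monom 1 k * p"] unfolding monom_mult by simp
    have "x ^ Suc k * poly (?P n) x =
        x ^ k * poly (?P (Suc n)) x + a * (x ^ k * poly (?P n) x) + b * (x ^ k * poly (?P (n - 1)) x)" for x
      unfolding meixner_poly_rec[OF n] by (simp add: algebra_simps)
    then have "(LINT x|M. x ^ Suc k * poly (?P n) x) =
        (LINT x|M. x ^ k * poly (?P (Suc n)) x + a * (x ^ k * poly (?P n) x) + b * (x ^ k * poly (?P (n - 1)) x))"
      by (simp only:)
    also have "\<dots> = (LINT x|M. x ^ k * poly (?P (Suc n)) x) + a * (LINT x|M. x ^ k * poly (?P n) x)
        + b * (LINT x|M. x ^ k * poly (?P (n - 1)) x)"
      using intk by simp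
    also have "\<dots> = 0"
      using Suc.prems by (simp add: Suc.IH)
    finally show ?case .
  qed (simp add: mean0)
  have lower: "(LINT x|M. poly q x * poly (?P n) x) = 0" if q: "degree q < n" for q n
  proof -
    have "(LINT x|M. poly q x * poly (?P n) x) = (LINT x|M. (\<Sum>i\<le>degree q. coeff q i * (x ^ i * poly (?P n) x)))"
      by (simp add: poly_altdef sum_distrib_right mult.assoc)
    also have "\<dots> = (\<Sum>i\<le>degree q. coeff q i * (LINT x|M. x ^ i * poly (?P n) x))"
    proof (subst Bochner_Integration.integral_sum)
      show "integrable M (\<lambda>x. coeff q i * (x ^ i * poly (?P n) x))" for i
        using int[of "monom (coeff q i) i * ?P n"] unfolding monom_mult by (simp add: mult.assoc)
    qed simp
    also have "\<dots> = 0" using q by (intro sum.neutral) (auto simp: power)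
    finally show ?thesis .
  qed
  show ?thesis
  proof (cases "m < n")
    case True
    then have "degree (?P m) < n" using meixner_poly_degree[of a b c \<alpha> m] by linarith
    then show ?thesis by (rule lower)
  next
    case False
    then have "degree (?P n) < m" using meixner_poly_degree[of a b c \<alpha> n] mn by linarith
    then show ?thesis using lower[of "?P n" m] by (simp add: mult.commute)
  qed
qed

text \<open>For \<open>n \<ge> 1\<close> the polynomial \<open>P\<^sub>n\<close> is monic of degree \<open>n\<close>, so subtracting multiples of the \<open>P\<^sub>n\<close> reduces
every polynomial to a constant without changing its mean.\<close>

lemma meixner_law_eqI:
  assumes M: "real_distribution M" "AE x in M. x \<in> {-R..R}"
    and mean0: "\<And>n. n \<ge> 1 \<Longrightarrow> (LINT x|M. poly (meixner_poly a b c \<alpha> n) x) = 0"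
    and N: "real_distribution N" "\<And>n. integrable N (\<lambda>x. x ^ n)"
    and mean0N: "\<And>n. n \<ge> 1 \<Longrightarrow> (LINT x|N. poly (meixner_poly a b c \<alpha> n) x) = 0"
  shows "M = N"
proof -
  interpret M: real_distribution M by fact
  interpret N: real_distribution N by fact
  have intM: "integrable M (poly p)" for p by (rule integrable_poly_bounded_support[OF M])
  have intN: "integrable N (poly p)" for p
    unfolding poly_altdef using N(2) by simp
  have "degree p \<le> n \<longrightarrow> (LINT x|M. poly p x) = (LINT x|N. poly p x)" for p n
  proof (induction n arbitrary: p)
    case 0
    show ?case
    proof
      assume "degree p \<le> 0"
      then obtain k where "p = [:k:]" by (auto elim: degree_eq_zeroE)
      then show "(LINT x|M. poly p x) = (LINT x|N. poly p x)"
        using M.prob_space N.prob_space by simp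
    qed
  next
    case (Suc n)
    show ?case
    proof
      assume d: "degree p \<le> Suc n"
      define P where "P = meixner_poly a b c \<alpha> (Suc n)"
      have P: "degree P \<le> Suc n" "coeff P (Suc n) = 1"
        "(LINT x|M. poly P x) = 0" "(LINT x|N. poly P x) = 0"
        using meixner_poly_degree[of a b c \<alpha> "Suc n"] mean0[of "Suc n"] mean0N[of "Suc n"]
        by (simp_all only: P_def)
      define q where "q = p - smult (coeff p (Suc n)) P"
      have "degree q \<le> n"
      proof (rule degree_le, intro allI impI)
        fix i assume "n < i"
        then show "coeff q i = 0"
          using d P by (cases "i = Suc n") (auto simp: q_def coeff_eq_0)
      qed
      then have eq: "(LINT x|M. poly q x) = (LINT x|N. poly q x)" using Suc.IH by blast
      have p: "poly p x = poly q x + coeff p (Suc n) * poly P x" for x by (simp add: q_def)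
      show "(LINT x|M. poly p x) = (LINT x|N. poly p x)"
        unfolding p using intM intN P eq by simp
    qed
  qed
  then have eq: "(LINT x|M. poly p x) = (LINT x|N. poly p x)" for p by blast
  have "(LINT x|M. x ^ n) = (LINT x|N. x ^ n)" for n
    using eq[of "monom 1 n"] by (simp add: poly_monom)
  then show ?thesis
    by (rule real_distribution_eq_moments[OF M(1) N(1) M(2) N(2)])
qed

lemma free_meixner_law_eqI:
  assumes M: "real_distribution M" "AE x in M. x \<in> {-R..R}" and c: "c \<noteq> 0"
    and mean0: "\<And>n. n \<ge> 1 \<Longrightarrow> (LINT x|M. poly (meixner_poly a b c \<alpha> n) x) = 0"
  shows "free_meixner_law a b c \<alpha> = M"
  unfolding free_meixner_law_def
proof (rule the_equality)
  show "real_distribution M \<and> (\<forall>n. integrable M (\<lambda>x. x ^ n)) \<and>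
     (\<forall>m n. m \<noteq> n \<longrightarrow>
        (LINT x|M. poly (meixner_poly a b c \<alpha> m) x * poly (meixner_poly a b c \<alpha> n) x) = 0)"
  proof (intro conjI allI impI)
    show "integrable M (\<lambda>x. x ^ n)" for n
      by (rule integrable_bounded_support[OF M]) (auto intro!: continuous_intros)
    show "(LINT x|M. poly (meixner_poly a b c \<alpha> m) x * poly (meixner_poly a b c \<alpha> n) x) = 0"
      if "m \<noteq> n" for m n by (rule meixner_orthogonal[OF M mean0 that])
  qed (rule M(1))
next
  fix N
  assume N: "real_distribution N \<and> (\<forall>n. integrable N (\<lambda>x. x ^ n)) \<and>
     (\<forall>m n. m \<noteq> n \<longrightarrow>
        (LINT x|N. poly (meixner_poly a b c \<alpha> m) x * poly (meixner_poly a b c \<alpha> n) x) = 0)"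
  have "(LINT x|N. poly (meixner_poly a b c \<alpha> n) x) = 0" if "n \<ge> 1" for n
  proof -
    have "(LINT x|N. poly (meixner_poly a b c \<alpha> 0) x * poly (meixner_poly a b c \<alpha> n) x) = 0"
      using N that by (metis not_one_le_zero)
    then show ?thesis using c by simp
  qed
  then show "N = M" using meixner_law_eqI[OF M mean0, of N] N by blast
qed

text \<open>The recurrence says that the generating function times \<open>1 - t (x - a) + b t\<^sup>2\<close> is affine in \<open>t\<close>;
truncation leaves two terms at the upper end.\<close>

lemma meixner_generating_sum:
  fixes a b c \<alpha> x t :: real
  defines "P \<equiv> \<lambda>n. poly (meixner_poly a b c \<alpha> n) x"
  shows "(1 - t * (x - a) + b * t\<^sup>2) * (\<Sum>k\<le>N. P k * t ^ k) =
    c + t * (x - \<alpha> - c * (x - a)) - t ^ Suc N * P (Suc N) + b * t ^ Suc (Suc N) * P N"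
proof (induction N)
  case 0
  show ?case by (simp add: P_def algebra_simps power2_eq_square)
next
  case (Suc N)
  have rec: "P (Suc (Suc N)) = (x - a) * P (Suc N) - b * P N" by (simp add: P_def algebra_simps)
  show ?case
    unfolding sum.atMost_Suc distrib_left Suc.IH rec by (simp add: algebra_simps power2_eq_square)
qed

text \<open>With \<open>y = 1/t - t/2\<close> the denominator \<open>1 - t (x - lam) + t\<^sup>2/2\<close> of the generating function is
\<open>t (z - x)\<close> with \<open>z = lam + \<surd>(y\<^sup>2 + 2)\<close>. So the hypothesis evaluates the integral of the generating
function: it is \<open>2\<close>, up to the truncation error of order \<open>t\<^sup>N\<^sup>+\<^sup>1\<close>. Comparing coefficients as \<open>t\<close>
tends to \<open>0\<close> gives the claim.\<close>

lemma meixner_mean_zero: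
  assumes M: "real_distribution M" "AE x in M. x \<in> {-R..R}" and R: "R > 0" and lam: "lam > 0" and Y: "Y \<ge> 0"
    and stieltjes: "\<And>y. y > Y \<Longrightarrow> (LINT x|M. 1 / (lam + sqrt (y\<^sup>2 + 2) - x)) = 1 / (lam + y)"
    and n: "n \<ge> 1"
  shows "(LINT x|M. poly (meixner_poly lam (1/2) 2 0 n) x) = 0"
proof -
  interpret real_distribution M by fact
  let ?P = "meixner_poly lam (1/2) 2 0"
  define p where "p n = (LINT x|M. poly (?P n) x)" for n
  have int: "integrable M (poly q)" for q by (rule integrable_poly_bounded_support[OF M])
  have p0: "p 0 = 2" using prob_space by (simp add: p_def)
  have bdd: "\<exists>B. \<forall>x\<in>{-R..R}. \<bar>poly q x\<bar> \<le> B" for q :: "real poly"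
  proof -
    have "bounded (poly q ` {-R..R})"
      by (intro compact_imp_bounded compact_continuous_image continuous_intros compact_Icc)
    then show ?thesis unfolding bounded_iff by auto
  qed
  \<comment> \<open>The bound \<open>1 / (2 R)\<close> keeps the denominator above \<open>1 / 2\<close> on the support, and
    \<open>1 / (Y + 1)\<close> makes \<open>1 / t - t / 2\<close> larger than \<open>Y\<close>.\<close>
  define t0 where "t0 = min 1 (min (1 / (2 * R)) (1 / (Y + 1)))"
  have t0: "t0 > 0" using R Y by (simp add: t0_def)
  have expansion: "\<exists>C. \<forall>t. 0 < t \<and> t < t0 \<longrightarrow> \<bar>(\<Sum>k\<le>N. p k * t ^ k) - 2\<bar> \<le> C * t ^ Suc N" for N
  proof -
    obtain B1 where B1: "\<And>x. x \<in> {-R..R} \<Longrightarrow> \<bar>poly (?P (Suc N)) x\<bar> \<le> B1" using bdd by blast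
    obtain B2 where B2: "\<And>x. x \<in> {-R..R} \<Longrightarrow> \<bar>poly (?P N) x\<bar> \<le> B2" using bdd by blast
    show ?thesis
    proof (intro exI[of _ "2 * (B1 + B2)"] allI impI)
      fix t assume t: "0 < t \<and> t < t0"
      have t1: "t < 1" "t * R < 1 / 2" "Y + 1 < 1 / t"
        using t R Y by (auto simp: t0_def field_simps)
      define y where "y = 1 / t - t / 2"
      have y: "y > Y" using t1 t unfolding y_def by linarith
      define D where "D x = 1 - t * (x - lam) + 1 / 2 * t\<^sup>2" for x
      have D2: "D x \<ge> 1 / 2" if "x \<in> {-R..R}" for x
      proof -
        have "t * (x - lam) \<le> t * R" using that lam t by (intro mult_left_mono) auto
        moreover have "0 \<le> 1 / 2 * t\<^sup>2" by simp
        ultimately show ?thesis using t1(2) unfolding D_def by linarith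
      qed
      have "y\<^sup>2 + 2 = (1 / t + t / 2)\<^sup>2"
        using t by (simp add: y_def power2_eq_square field_simps)
      then have s: "sqrt (y\<^sup>2 + 2) = 1 / t + t / 2" using t by simp
      have Dz: "D x = t * (lam + sqrt (y\<^sup>2 + 2) - x)" for x
        unfolding s D_def using t by (simp add: power2_eq_square field_simps)
      have den: "t * (lam + y) = 1 + t * lam - 1 / 2 * t\<^sup>2"
        using t by (simp add: y_def power2_eq_square field_simps)
      have cD: "continuous_on {-R..R} (\<lambda>x. 1 / D x)"
        using D2 unfolding D_def by (intro continuous_intros) force
      have mD: "(\<lambda>x. 1 / D x) \<in> borel_measurable borel" unfolding D_def by simp
      have intD: "integrable M (\<lambda>x. 1 / D x)"
        by (rule integrable_bounded_support[OF M cD mD])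
      have "(LINT x|M. 1 / D x) = (LINT x|M. 1 / t * (1 / (lam + sqrt (y\<^sup>2 + 2) - x)))"
        unfolding Dz by simp
      also have "\<dots> = 1 / t * (1 / (lam + y))"
        by (simp only: integral_mult_right_zero stieltjes[OF y])
      finally have "(LINT x|M. 1 / D x) = 1 / (1 + t * lam - 1 / 2 * t\<^sup>2)"
        unfolding den[symmetric] by simp
      moreover have "1 + t * lam - 1 / 2 * t\<^sup>2 \<noteq> 0"
        unfolding den[symmetric] using t y Y lam by auto
      ultimately have LD: "(1 + t * lam - 1 / 2 * t\<^sup>2) * (LINT x|M. 1 / D x) = 1" by simp
      define E where "E x = t ^ Suc N * (poly (?P (Suc N)) x - t / 2 * poly (?P N) x) / D x" for x
      have cE: "continuous_on {-R..R} E"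
        unfolding E_def using D2 unfolding D_def by (intro continuous_intros) force
      have mE: "E \<in> borel_measurable borel"
        unfolding E_def D_def
        by (intro borel_measurable_divide borel_measurable_times borel_measurable_diff borel_measurable_const
            borel_measurable_continuous_onI continuous_intros) auto
      have intE: "integrable M E"
        by (rule integrable_bounded_support[OF M cE mE])
      have lin: "(LINT x|M. 1 + K * h x - E x) = (LINT x|M. 1) + K * (LINT x|M. h x) - (LINT x|M. E x)"
        if "integrable M h" for K and h :: "real \<Rightarrow> real"
        using that intE by (simp del: lebesgue_integral_const)
      have gen: "(\<Sum>k\<le>N. poly (?P k) x * t ^ k) =
          1 + (1 + t * lam - 1 / 2 * t\<^sup>2) * (1 / D x) - E x" if x: "x \<in> {-R..R}" for x
      proof -
        have nz: "D x \<noteq> 0" using D2[OF x] by auto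
        have "D x * (\<Sum>k\<le>N. poly (?P k) x * t ^ k) =
          2 + t * (x - 0 - 2 * (x - lam)) - t ^ Suc N * poly (?P (Suc N)) x + 1 / 2 * t ^ Suc (Suc N) * poly (?P N) x"
          unfolding D_def by (rule meixner_generating_sum)
        also have "\<dots> = D x + (1 + t * lam - 1 / 2 * t\<^sup>2) - t ^ Suc N * (poly (?P (Suc N)) x - t / 2 * poly (?P N) x)"
          unfolding D_def by (simp add: algebra_simps power2_eq_square)
        finally have "(\<Sum>k\<le>N. poly (?P k) x * t ^ k) =
          (D x + (1 + t * lam - 1 / 2 * t\<^sup>2) - t ^ Suc N * (poly (?P (Suc N)) x - t / 2 * poly (?P N) x)) / D x"
          using nz by (simp add: eq_divide_eq mult.commute)
        then show ?thesis using nz by (simp add: E_def add_divide_distrib diff_divide_distrib)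
      qed
      have "(\<Sum>k\<le>N. p k * t ^ k) = (LINT x|M. (\<Sum>k\<le>N. poly (?P k) x * t ^ k))"
        using int by (simp add: p_def)
      also have "\<dots> = (LINT x|M. 1 + (1 + t * lam - 1 / 2 * t\<^sup>2) * (1 / D x) - E x)"
      proof (rule integral_cong_AE)
        show "(\<lambda>x. \<Sum>k\<le>N. poly (?P k) x * t ^ k) \<in> borel_measurable M"
          using int by (intro borel_measurable_integrable) simp
        show "(\<lambda>x. 1 + (1 + t * lam - 1 / 2 * t\<^sup>2) * (1 / D x) - E x) \<in> borel_measurable M"
          by (intro borel_measurable_integrable Bochner_Integration.integrable_diff
              Bochner_Integration.integrable_add integrable_mult_right intD intE) simp
        show "AE x in M. (\<Sum>k\<le>N. poly (?P k) x * t ^ k) = 1 + (1 + t * lam - 1 / 2 * t\<^sup>2) * (1 / D x) - E x"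
          by (rule eventually_mono[OF M(2)]) (rule gen)
      qed
      also have "\<dots> = (LINT x|M. 1) + (1 + t * lam - 1 / 2 * t\<^sup>2) * (LINT x|M. 1 / D x) - (LINT x|M. E x)"
        by (rule lin[OF intD])
      also have "\<dots> = 2 - (LINT x|M. E x)"
        unfolding LD by (simp only: lebesgue_integral_const prob_space scaleR_one)
      finally have "\<bar>(\<Sum>k\<le>N. p k * t ^ k) - 2\<bar> = \<bar>LINT x|M. E x\<bar>" by simp
      also have "\<dots> \<le> (LINT x|M. \<bar>E x\<bar>)" by (rule integral_abs_bound)
      also have "\<dots> \<le> (LINT x|M. 2 * (B1 + B2) * t ^ Suc N)"
      proof (rule integral_mono_AE)
        show "AE x in M. \<bar>E x\<bar> \<le> 2 * (B1 + B2) * t ^ Suc N"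
        proof (rule eventually_mono[OF M(2)])
          fix x assume x: "x \<in> {-R..R}"
          have "\<bar>poly (?P (Suc N)) x - t / 2 * poly (?P N) x\<bar> \<le> \<bar>poly (?P (Suc N)) x\<bar> + \<bar>t / 2 * poly (?P N) x\<bar>"
            by (rule abs_triangle_ineq4)
          also have "\<bar>t / 2 * poly (?P N) x\<bar> \<le> 1 * \<bar>poly (?P N) x\<bar>"
            unfolding abs_mult using t t1 by (intro mult_right_mono) auto
          finally have le: "\<bar>poly (?P (Suc N)) x - t / 2 * poly (?P N) x\<bar> \<le> B1 + B2"
            using B1[OF x] B2[OF x] by linarith
          have "\<bar>E x\<bar> = t ^ Suc N * \<bar>poly (?P (Suc N)) x - t / 2 * poly (?P N) x\<bar> / D x"
            using t D2[OF x] by (simp add: E_def abs_mult)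
          also have "\<dots> \<le> t ^ Suc N * (B1 + B2) / (1 / 2)"
            using t D2[OF x] le by (intro frac_le mult_left_mono mult_nonneg_nonneg) (auto intro: order_trans[OF abs_ge_zero])
          finally show "\<bar>E x\<bar> \<le> 2 * (B1 + B2) * t ^ Suc N" by (simp add: algebra_simps)
        qed
      qed (use intE in auto)
      also have "\<dots> = 2 * (B1 + B2) * t ^ Suc N"
        by (simp only: lebesgue_integral_const prob_space scaleR_one)
      finally show "\<bar>(\<Sum>k\<le>N. p k * t ^ k) - 2\<bar> \<le> 2 * (B1 + B2) * t ^ Suc N" .
    qed
  qed
  have "p n = 0" if "n \<ge> 1" for n
    using that
  proof (induction n rule: less_induct)
    case (less n)
    obtain C where C: "\<And>t. 0 < t \<Longrightarrow> t < t0 \<Longrightarrow> \<bar>(\<Sum>k\<le>n. p k * t ^ k) - 2\<bar> \<le> C * t ^ Suc n"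
      using expansion by blast
    have "\<bar>p n\<bar> \<le> C * t" if t: "0 < t" "t < t0" for t
    proof -
      have "(\<Sum>k\<le>n. p k * t ^ k) = (\<Sum>k\<in>{0, n}. p k * t ^ k)"
        by (rule sum.mono_neutral_right) (use less in auto)
      also have "\<dots> = 2 + p n * t ^ n" using less.prems by (simp add: p0)
      finally have "\<bar>p n\<bar> * t ^ n \<le> (C * t) * t ^ n"
        using C[OF t] t by (simp add: abs_mult mult_ac)
      then show ?thesis using t by simp
    qed
    then have "eventually (\<lambda>t. \<bar>p n\<bar> \<le> C * t) (at_right 0)"
      using t0 by (auto simp: eventually_at_right_field)
    moreover have "((\<lambda>t. C * t) \<longlongrightarrow> C * 0) (at_right 0)" by (intro tendsto_intros)
    ultimately have "\<bar>p n\<bar> \<le> C * 0"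
      by (intro tendsto_lowerbound[of "\<lambda>t. C * t"]) auto
    then show ?case by simp
  qed
  then show ?thesis using n by (simp add: p_def)
qed

section \<open>The explicit limit law\<close>

text \<open>The integrand has an elementary antiderivative that is continuous up to the end points, where both
arguments of \<open>arcsin\<close> are \<open>1\<close> or \<open>-1\<close>.\<close>

lemma semicircle_stieltjes_integral:
  fixes r a :: real
  assumes r: "0 < r" and a: "r < a"
  shows "((\<lambda>u. sqrt (r\<^sup>2 - u\<^sup>2) / (a - u)) has_integral pi * (a - sqrt (a\<^sup>2 - r\<^sup>2))) {-r..r}"
proof -
  define k where "k = sqrt (a\<^sup>2 - r\<^sup>2)"
  have k2: "k\<^sup>2 = a\<^sup>2 - r\<^sup>2" "k > 0"
    using r a by (auto simp: k_def power_strict_mono)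
  \<comment> \<open>\<open>r\<^sup>2 - u\<^sup>2 = (a + u) (a - u) - k\<^sup>2\<close> splits the integrand: the first part gives the first two
    terms of \<open>F\<close>. The function \<open>v\<close> is the Moebius map that takes \<open>r\<close> to \<open>1\<close>,
    \<open>-r\<close> to \<open>-1\<close> and \<open>a\<close> to infinity.\<close>
  define v where "v u = (a * u - r\<^sup>2) / (r * (a - u))" for u
  define F where "F u = a * arcsin (u / r) - sqrt (r\<^sup>2 - u\<^sup>2) - k * arcsin (v u)" for u
  have v_sq: "1 - (v u)\<^sup>2 = k\<^sup>2 * (r\<^sup>2 - u\<^sup>2) / (r * (a - u))\<^sup>2" if "u < a" for u
  proof -
    have "r * (a - u) \<noteq> 0" using r that by simp
    then have "1 - (v u)\<^sup>2 = ((r * (a - u))\<^sup>2 - (a * u - r\<^sup>2)\<^sup>2) / (r * (a - u))\<^sup>2"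
      unfolding v_def power_divide by (simp add: diff_divide_distrib)
    also have "(r * (a - u))\<^sup>2 - (a * u - r\<^sup>2)\<^sup>2 = k\<^sup>2 * (r\<^sup>2 - u\<^sup>2)"
      unfolding k2 by (simp add: power2_eq_square algebra_simps)
    finally show ?thesis .
  qed
  have u_sq: "u\<^sup>2 \<le> r\<^sup>2" if "u \<in> {-r..r}" for u
    using that by (simp add: abs_le_square_iff[symmetric] abs_le_iff r)
  have v_range: "-1 \<le> v u \<and> v u \<le> 1" if u: "u \<in> {-r..r}" for u
  proof -
    have "0 \<le> 1 - (v u)\<^sup>2" using v_sq[of u] u_sq[OF u] u a by simp
    then have "\<bar>v u\<bar> \<le> 1" by (simp add: abs_square_le_1[symmetric])
    then show ?thesis by linarith
  qed
  have contF: "continuous_on {-r..r} F"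
    unfolding F_def
  proof (intro continuous_intros continuous_on_arcsin')
    show "continuous_on {-r..r} v"
      unfolding v_def using r a by (intro continuous_intros) auto
  qed (use v_range r in \<open>auto simp: field_simps\<close>)
  have deriv: "(F has_real_derivative sqrt (r\<^sup>2 - u\<^sup>2) / (a - u)) (at u)" if u: "u \<in> {-r<..<r}" for u
  proof -
    have au: "a - u > 0" using u a by simp
    have "u\<^sup>2 < r\<^sup>2" using u power_strict_mono[of "\<bar>u\<bar>" r 2] by auto
    then have w: "r\<^sup>2 - u\<^sup>2 > 0" by simp
    define s where "s = sqrt (r\<^sup>2 - u\<^sup>2)"
    have s: "s > 0" "s\<^sup>2 = r\<^sup>2 - u\<^sup>2" using w by (auto simp: s_def)
    have dv: "(v has_real_derivative k\<^sup>2 / (r * (a - u)\<^sup>2)) (at u)"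
    proof -
      have nz: "r * (a - u) \<noteq> 0" using r au by simp
      have "(v has_real_derivative
          (a * (r * (a - u)) - (a * u - r\<^sup>2) * (- r)) / (r * (a - u) * (r * (a - u)))) (at u)"
        unfolding v_def by (rule DERIV_divide) (use r au in \<open>auto intro!: derivative_eq_intros\<close>)
      moreover have "a * (r * (a - u)) - (a * u - r\<^sup>2) * (- r) = r * k\<^sup>2"
        unfolding k2 by (simp add: power2_eq_square algebra_simps)
      moreover have "r * k\<^sup>2 / (r * (a - u) * (r * (a - u))) = k\<^sup>2 / (r * (a - u)\<^sup>2)"
        using nz by (simp add: power2_eq_square)
      ultimately show ?thesis by simp
    qed
    have "1 - (v u)\<^sup>2 = (k * s / (r * (a - u)))\<^sup>2"
      using v_sq[of u] au s by (simp add: power_divide power_mult_distrib)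
    then have sv: "sqrt (1 - (v u)\<^sup>2) = k * s / (r * (a - u))"
      using k2 s r au by (simp add: real_sqrt_unique)
    have "0 < k * s / (r * (a - u))" using k2 s r au by simp
    then have "(v u)\<^sup>2 < 1" unfolding sv[symmetric] by simp
    then have v1: "- 1 < v u" "v u < 1" by (auto simp: abs_square_less_1 abs_less_iff)
    have u1: "- 1 < u / r" "u / r < 1" using u r by (auto simp: field_simps)
    have su: "sqrt (1 - (u / r)\<^sup>2) = s / r"
    proof -
      have "1 - (u / r)\<^sup>2 = (s / r)\<^sup>2" unfolding power_divide s(2) using r by (simp add: diff_divide_distrib)
      then show ?thesis using s r by (simp add: real_sqrt_unique)
    qed
    have d1: "((\<lambda>u. a * arcsin (u / r)) has_real_derivative a / s) (at u)"
    proof -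
      have "((\<lambda>u. arcsin (u / r)) has_real_derivative inverse (sqrt (1 - (u / r)\<^sup>2)) * (1 / r)) (at u)"
        by (rule DERIV_chain2[where f = arcsin and g = "\<lambda>u. u / r", OF DERIV_arcsin[OF u1]]) (use r in \<open>auto intro!: derivative_eq_intros\<close>)
      from DERIV_cmult[OF this, of a] show ?thesis
        unfolding su using r s by simp
    qed
    have d2: "((\<lambda>u. sqrt (r\<^sup>2 - u\<^sup>2)) has_real_derivative - u / s) (at u)"
      using w by (auto intro!: derivative_eq_intros simp: s_def field_simps)
    have d3: "((\<lambda>u. k * arcsin (v u)) has_real_derivative k\<^sup>2 / ((a - u) * s)) (at u)"
    proof -
      have "((\<lambda>u. arcsin (v u)) has_real_derivative
          inverse (sqrt (1 - (v u)\<^sup>2)) * (k\<^sup>2 / (r * (a - u)\<^sup>2))) (at u)"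
        by (rule DERIV_chain2[where f = arcsin and g = v, OF DERIV_arcsin[OF v1] dv])
      then have "((\<lambda>u. k * arcsin (v u)) has_real_derivative
          k * (inverse (k * s / (r * (a - u))) * (k\<^sup>2 / (r * (a - u)\<^sup>2)))) (at u)"
        unfolding sv by (rule DERIV_cmult)
      moreover have "k * (inverse (k * s / (r * d)) * (k\<^sup>2 / (r * d\<^sup>2))) = k\<^sup>2 / (d * s)" if "d > 0" for d
        using r s(1) k2(2) that by (simp add: field_simps power2_eq_square)
      ultimately show ?thesis by (simp only: au)
    qed
    have "a / s - (- u / s) - k\<^sup>2 / ((a - u) * s) = s / (a - u)"
    proof -
      have "a / s - (- u / s) - k\<^sup>2 / ((a - u) * s) = ((a + u) * (a - u) - k\<^sup>2) / ((a - u) * s)"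
        using s au by (simp add: field_simps)
      also have "(a + u) * (a - u) - k\<^sup>2 = s\<^sup>2" unfolding k2 s(2) by (simp add: power2_eq_square algebra_simps)
      finally show ?thesis using s by (simp add: power2_eq_square)
    qed
    with DERIV_diff[OF DERIV_diff[OF d1 d2] d3] show ?thesis
      unfolding F_def s_def[symmetric] by simp
  qed
  have "((\<lambda>u. sqrt (r\<^sup>2 - u\<^sup>2) / (a - u)) has_integral F r - F (- r)) {-r..r}"
    by (rule fundamental_theorem_of_calculus_interior)
       (use r contF deriv in \<open>auto simp: has_real_derivative_iff_has_vector_derivative\<close>)
  also have "F r - F (- r) = pi * (a - k)"
  proof -
    have "v r = 1" "v (- r) = - 1"
    proof -
      have "a * r - r\<^sup>2 = r * (a - r)" "a * (- r) - r\<^sup>2 = - (r * (a - (- r)))"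
        by (simp_all add: power2_eq_square algebra_simps)
      moreover have "r * (a - r) \<noteq> 0" "r * (a - (- r)) \<noteq> 0" using r a by auto
      ultimately show "v r = 1" "v (- r) = - 1"
        unfolding v_def by (metis divide_self, metis divide_self minus_divide_left)
    qed
    then show ?thesis using r by (simp add: F_def algebra_simps)
  qed
  finally show ?thesis by (simp add: k_def)
qed

definition limit_density :: "real \<Rightarrow> real \<Rightarrow> real" where
  "limit_density lam x = sqrt (2 - (x - lam)\<^sup>2) / (pi * (lam\<^sup>2 + 2 - (x - lam)\<^sup>2))
     * indicator {lam - sqrt 2 <..< lam + sqrt 2} x"

text \<open>The sum of the atom and the absolutely continuous part, written as a composition of the counting
measure on two points with a kernel.\<close>

definition limit_law :: "real \<Rightarrow> real measure" where
  "limit_law lam = count_space (UNIV :: bool set) \<bind> (\<lambda>atom.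
     if atom then scale_measure (ennreal (lam / sqrt (lam\<^sup>2 + 2))) (return borel (lam - sqrt (lam\<^sup>2 + 2)))
     else density lborel (\<lambda>x. ennreal (limit_density lam x)))"

lemma limit_density_measurable [measurable]: "limit_density lam \<in> borel_measurable borel"
  unfolding limit_density_def[abs_def] by measurable

lemma limit_density_nonneg: "0 \<le> limit_density lam x"
proof (cases "x \<in> {lam - sqrt 2 <..< lam + sqrt 2}")
  case True
  then have "\<bar>x - lam\<bar> < sqrt 2" by (auto simp: abs_less_iff)
  then have "(x - lam)\<^sup>2 < 2" using power_strict_mono[of "\<bar>x - lam\<bar>" "sqrt 2" 2] by simp
  then have "(x - lam)\<^sup>2 \<le> 2" "(x - lam)\<^sup>2 \<le> lam\<^sup>2 + 2" using zero_le_power2[of lam] by linarith+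
  then show ?thesis by (simp add: limit_density_def)
qed (simp add: limit_density_def)

text \<open>In what follows \<open>c\<close> is the distance of the atom from the centre of the density.\<close>

context
  fixes lam c :: real
  assumes lam: "lam > 0"
  defines "c \<equiv> sqrt (lam\<^sup>2 + 2)"
begin

lemma atom_distance: "c\<^sup>2 = lam\<^sup>2 + 2" "c > sqrt 2" "c > lam" "c > 0"
proof -
  show c2: "c\<^sup>2 = lam\<^sup>2 + 2" by (simp add: c_def)
  show "c > sqrt 2" using lam by (simp add: c_def)
  show "c > lam" unfolding c_def using lam by (intro real_less_rsqrt) simp
  then show "c > 0" using lam by simp
qed

text \<open>At the two poles \<open>\<plusminus> c\<close> of the density (seen from its centre) the square root \<open>\<surd>(c\<^sup>2 - 2)\<close> is \<open>lam\<close>,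
which is the source of the weight of the atom.\<close>

lemma sqrt2_pole_integrals:
  "((\<lambda>u. sqrt (2 - u\<^sup>2) / (c - u)) has_integral pi * (c - lam)) {-sqrt 2..sqrt 2}"
  "((\<lambda>u. sqrt (2 - u\<^sup>2) / (c + u)) has_integral pi * (c - lam)) {-sqrt 2..sqrt 2}"
proof -
  have "sqrt (c\<^sup>2 - 2) = lam" using lam by (simp add: atom_distance)
  then show 1: "((\<lambda>u. sqrt (2 - u\<^sup>2) / (c - u)) has_integral pi * (c - lam)) {-sqrt 2..sqrt 2}"
    using semicircle_stieltjes_integral[of "sqrt 2" c] atom_distance by simp
  show "((\<lambda>u. sqrt (2 - u\<^sup>2) / (c + u)) has_integral pi * (c - lam)) {-sqrt 2..sqrt 2}"
    using has_integral_reflect_lemma_real[OF 1] by simp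
qed

lemma ac_mass_integral:
  "((\<lambda>u. sqrt (2 - u\<^sup>2) / (pi * (c\<^sup>2 - u\<^sup>2))) has_integral (c - lam) / c) {-sqrt 2..sqrt 2}"
proof -
  have I: "((\<lambda>u. (1 / (2 * c * pi)) * (sqrt (2 - u\<^sup>2) / (c - u) + sqrt (2 - u\<^sup>2) / (c + u)))
     has_integral (1 / (2 * c * pi)) * (pi * (c - lam) + pi * (c - lam))) {-sqrt 2..sqrt 2}"
    by (intro has_integral_mult_right has_integral_add sqrt2_pole_integrals)
  have V: "(1 / (2 * c * pi)) * (pi * (c - lam) + pi * (c - lam)) = (c - lam) / c"
    using atom_distance by (simp add: field_simps)
  have F: "(1 / (2 * c * pi)) * (sqrt (2 - u\<^sup>2) / (c - u) + sqrt (2 - u\<^sup>2) / (c + u))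
      = sqrt (2 - u\<^sup>2) / (pi * (c\<^sup>2 - u\<^sup>2))" if "u \<in> {-sqrt 2..sqrt 2}" for u
  proof -
    have nz: "c - u \<noteq> 0" "c + u \<noteq> 0" "c \<noteq> 0" using that atom_distance by auto
    have cu: "c\<^sup>2 - u\<^sup>2 = (c - u) * (c + u)" by (simp add: power2_eq_square algebra_simps)
    show ?thesis unfolding cu using nz by (simp add: divide_simps) (simp add: algebra_simps)
  qed
  show ?thesis using has_integral_eq[OF F I] unfolding V .
qed

lemma ac_stieltjes_integral:
  assumes y: "y > lam"
  defines "a \<equiv> sqrt (y\<^sup>2 + 2)"
  shows "((\<lambda>u. 1 / (a - u) * (sqrt (2 - u\<^sup>2) / (pi * (c\<^sup>2 - u\<^sup>2))))
    has_integral 1 / (lam + y) - lam / c * (1 / (a + c))) {-sqrt 2..sqrt 2}"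
proof -
  have a2: "a\<^sup>2 = y\<^sup>2 + 2" by (simp add: a_def)
  have ac: "a > c" unfolding a_def c_def using lam y by (simp add: power_strict_mono)
  have "sqrt (a\<^sup>2 - 2) = y" using lam y by (simp add: a2)
  then have A: "((\<lambda>u. sqrt (2 - u\<^sup>2) / (a - u)) has_integral pi * (a - y)) {-sqrt 2..sqrt 2}"
    using semicircle_stieltjes_integral[of "sqrt 2" a] ac atom_distance by simp
  \<comment> \<open>The residues of \<open>1 / (pi (a - u) (c\<^sup>2 - u\<^sup>2))\<close> at \<open>a\<close>, \<open>c\<close> and \<open>-c\<close>, up to sign.\<close>
  let ?A = "1 / (pi * (c\<^sup>2 - a\<^sup>2))" and ?B = "1 / (pi * (2 * c * (a - c)))" and ?C = "1 / (pi * (2 * c * (a + c)))"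
  have I: "((\<lambda>u. ?A * (sqrt (2 - u\<^sup>2) / (a - u)) + ?B * (sqrt (2 - u\<^sup>2) / (c - u)) + ?C * (sqrt (2 - u\<^sup>2) / (c + u)))
     has_integral ?A * (pi * (a - y)) + ?B * (pi * (c - lam)) + ?C * (pi * (c - lam))) {-sqrt 2..sqrt 2}"
    by (intro has_integral_mult_right has_integral_add sqrt2_pole_integrals A)
  have nz: "a - c \<noteq> 0" "a + c \<noteq> 0" "c \<noteq> 0" "lam + y \<noteq> 0" "c\<^sup>2 - a\<^sup>2 \<noteq> 0"
    using ac atom_distance y lam by (auto simp: a2)
  have V: "?A * (pi * (a - y)) + ?B * (pi * (c - lam)) + ?C * (pi * (c - lam)) = 1 / (lam + y) - lam / c * (1 / (a + c))"
  proof -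
    have ca: "c\<^sup>2 - a\<^sup>2 = - ((a - c) * (a + c))" by (simp add: power2_eq_square algebra_simps)
    have ya: "(y - lam) * (lam + y) = (a - c) * (a + c)"
    proof -
      have "(a - c) * (a + c) = a\<^sup>2 - c\<^sup>2" by (simp add: power2_eq_square algebra_simps)
      then show ?thesis unfolding a2 atom_distance by (simp add: power2_eq_square algebra_simps)
    qed
    have "1 / (lam + y) = (y - lam) / ((a - c) * (a + c))"
      unfolding ya[symmetric] using y nz by simp
    moreover have "?A * (pi * (a - y)) + ?B * (pi * (c - lam)) + ?C * (pi * (c - lam)) =
        (y - lam) / ((a - c) * (a + c)) - lam / c * (1 / (a + c))"
      unfolding ca using nz by (simp add: divide_simps) (simp add: algebra_simps)
    ultimately show ?thesis by simp
  qed
  have F: "?A * (sqrt (2 - u\<^sup>2) / (a - u)) + ?B * (sqrt (2 - u\<^sup>2) / (c - u)) + ?C * (sqrt (2 - u\<^sup>2) / (c + u))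
      = 1 / (a - u) * (sqrt (2 - u\<^sup>2) / (pi * (c\<^sup>2 - u\<^sup>2)))" if "u \<in> {-sqrt 2..sqrt 2}" for u
  proof -
    have nzu: "c - u \<noteq> 0" "c + u \<noteq> 0" "a - u \<noteq> 0" using that atom_distance ac by auto
    have cu: "c\<^sup>2 - u\<^sup>2 = (c - u) * (c + u)" "c\<^sup>2 - a\<^sup>2 = (c - a) * (c + a)" by (simp_all add: power2_eq_square algebra_simps)
    define S where "S = sqrt (2 - u\<^sup>2)"
    have "1 / ((c - a) * (c + a)) / (a - u) + 1 / (2 * c * (a - c)) / (c - u) + 1 / (2 * c * (a + c)) / (c + u)
      = 1 / (a - u) / ((c - u) * (c + u))"
      using nz nzu by (simp add: divide_simps) (simp add: algebra_simps)
    then have "S / pi * (1 / ((c - a) * (c + a)) / (a - u) + 1 / (2 * c * (a - c)) / (c - u) + 1 / (2 * c * (a + c)) / (c + u))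
      = S / pi * (1 / (a - u) / ((c - u) * (c + u)))" by (simp only:)
    moreover have "1 / (pi * X) * (S / Y) = S / pi * (1 / X / Y)" "1 / Y * (S / (pi * X)) = S / pi * (1 / Y / X)" for X Y
      by simp_all
    ultimately show ?thesis unfolding cu S_def[symmetric] distrib_left[of "S / pi"] by (simp only:)
  qed
  show ?thesis
    using has_integral_eq[OF F I] unfolding V .
qed



lemma nn_integral_limit_density:
  assumes I: "((\<lambda>u. g (u + lam) * (sqrt (2 - u\<^sup>2) / (pi * (c\<^sup>2 - u\<^sup>2)))) has_integral I) {-sqrt 2..sqrt 2}"
    and g: "\<And>u. u \<in> {-sqrt 2..sqrt 2} \<Longrightarrow> 0 \<le> g (u + lam)" and [measurable]: "g \<in> borel_measurable borel"
  shows "(\<integral>\<^sup>+ x. ennreal (limit_density lam x) * ennreal (g x) \<partial>lborel) = ennreal I"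
proof -
  let ?h = "\<lambda>u. g (u + lam) * (sqrt (2 - u\<^sup>2) / (pi * (c\<^sup>2 - u\<^sup>2)))"
  have sq: "u\<^sup>2 \<le> 2" if "u \<in> {-sqrt 2..sqrt 2}" for u
    using that power_mono[of "\<bar>u\<bar>" "sqrt 2" 2] by auto
  have h: "0 \<le> ?h u" if "u \<in> {-sqrt 2..sqrt 2}" for u
  proof -
    have "u\<^sup>2 \<le> c\<^sup>2" using sq[OF that] zero_le_power2[of lam] unfolding atom_distance(1) by linarith
    then show ?thesis using g[OF that] sq[OF that] by simp
  qed
  have "(\<integral>\<^sup>+ x. ennreal (limit_density lam x) * ennreal (g x) \<partial>lborel)
    = (\<integral>\<^sup>+ u. ennreal (limit_density lam (lam + 1 * u)) * ennreal (g (lam + 1 * u)) \<partial>lborel)"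
    by (subst nn_integral_real_affine[where t = lam and c = 1]) simp_all
  also have "\<dots> = (\<integral>\<^sup>+ u. ennreal (?h u) * indicator {-sqrt 2..sqrt 2} u \<partial>lborel)"
  proof (rule nn_integral_cong)
    fix u :: real
    have "ennreal (limit_density lam (lam + u)) * ennreal (g (lam + u)) = ennreal (limit_density lam (lam + u) * g (lam + u))"
      if "u \<in> {-sqrt 2..sqrt 2}"
      using g[OF that] limit_density_nonneg by (simp add: ennreal_mult add.commute)
    moreover have "limit_density lam (lam + u) * g (lam + u) = ?h u" if "u \<in> {-sqrt 2..sqrt 2}"
      using that unfolding limit_density_def atom_distance(1)
      by (cases "u = sqrt 2 \<or> u = - sqrt 2") (auto simp: add.commute)
    moreover have "limit_density lam (lam + u) = 0" if "u \<notin> {-sqrt 2..sqrt 2}"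
      using that by (auto simp: limit_density_def)
    ultimately show "ennreal (limit_density lam (lam + 1 * u)) * ennreal (g (lam + 1 * u)) =
        ennreal (?h u) * indicator {-sqrt 2..sqrt 2} u"
      by (cases "u \<in> {-sqrt 2..sqrt 2}") simp_all
  qed
  also have "\<dots> = ennreal I"
    by (rule nn_integral_has_integral_lebesgue'[OF h I])
  finally show ?thesis .
qed

lemma limit_density_mass: "(\<integral>\<^sup>+ x. ennreal (limit_density lam x) \<partial>lborel) = ennreal ((c - lam) / c)"
  using nn_integral_limit_density[of "\<lambda>_. 1"] ac_mass_integral by simp

lemma nn_integral_limit_law:
  assumes [measurable]: "f \<in> borel_measurable borel"
  shows "(\<integral>\<^sup>+ x. f x \<partial>limit_law lam) =
    ennreal (lam / c) * f (lam - c) + (\<integral>\<^sup>+ x. ennreal (limit_density lam x) * f x \<partial>lborel)"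
proof -
  let ?K = "\<lambda>atom. if atom then scale_measure (ennreal (lam / c)) (return borel (lam - c))
     else density lborel (\<lambda>x. ennreal (limit_density lam x))"
  have "subprob_space (?K b)" for b
  proof (cases b)
    case True
    have "ennreal (lam / c) \<le> 1" using atom_distance lam by simp
    then show ?thesis using True
      by (intro subprob_spaceI) (simp_all add: space_scale_measure)
  next
    case False
    have "ennreal ((c - lam) / c) \<le> 1" using atom_distance lam by simp
    then show ?thesis using False
      by (intro subprob_spaceI) (auto simp: emeasure_density limit_density_mass)
  qed
  then have K: "?K \<in> measurable (count_space UNIV) (subprob_algebra borel)"
    by (auto simp: space_subprob_algebra)
  have "(\<integral>\<^sup>+ x. f x \<partial>limit_law lam) = (\<integral>\<^sup>+ b. \<integral>\<^sup>+ x. f x \<partial>?K b \<partial>count_space UNIV)"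
    unfolding limit_law_def c_def[symmetric] by (rule nn_integral_bind[OF _ K]) simp
  also have "\<dots> = (\<integral>\<^sup>+ x. f x \<partial>?K True) + (\<integral>\<^sup>+ x. f x \<partial>?K False)"
    by (simp add: nn_integral_count_space_finite UNIV_bool add.commute)
  also have "\<dots> = ennreal (lam / c) * f (lam - c) + (\<integral>\<^sup>+ x. ennreal (limit_density lam x) * f x \<partial>lborel)"
    by (simp add: nn_integral_scale_measure nn_integral_return nn_integral_density)
  finally show ?thesis .
qed

lemma sets_limit_law: "sets (limit_law lam) = sets borel"
  unfolding limit_law_def by (rule sets_bind) auto

lemma emeasure_limit_law:
  assumes B: "B \<in> sets borel"
  shows "emeasure (limit_law lam) B = ennreal (lam / c) * emeasure (return borel (lam - c)) B
       + emeasure (density lborel (\<lambda>x. ennreal (limit_density lam x))) B"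
proof -
  have "emeasure (limit_law lam) B = (\<integral>\<^sup>+ x. indicator B x \<partial>limit_law lam)"
    using B sets_limit_law by simp
  also have "\<dots> = ennreal (lam / c) * indicator B (lam - c) + (\<integral>\<^sup>+ x. ennreal (limit_density lam x) * indicator B x \<partial>lborel)"
    using B by (intro nn_integral_limit_law) simp
  finally show ?thesis using B by (simp add: emeasure_density)
qed

lemma real_distribution_limit_law: "real_distribution (limit_law lam)"
proof -
  have "emeasure (limit_law lam) UNIV = ennreal (lam / c) + ennreal ((c - lam) / c)"
    by (simp add: emeasure_limit_law emeasure_density limit_density_mass)
  also have "\<dots> = ennreal (lam / c + (c - lam) / c)"
    using atom_distance lam by (intro ennreal_plus[symmetric]) auto
  also have "lam / c + (c - lam) / c = 1" using atom_distance by (simp add: field_simps)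
  finally have "emeasure (limit_law lam) (space (limit_law lam)) = 1"
    using sets_eq_imp_space_eq[OF sets_limit_law] by simp
  then show ?thesis
    unfolding real_distribution_def real_distribution_axioms_def
    using sets_limit_law by (auto intro!: prob_spaceI)
qed

lemma limit_law_support: "AE x in limit_law lam. x \<in> {-(lam + c)..lam + c}"
proof (rule AE_I)
  have "limit_density lam x = 0" if "x \<notin> {-(lam + c)..lam + c}" for x
    using that atom_distance lam by (auto simp: limit_density_def split: split_indicator)
  then have "ennreal (limit_density lam x) * indicator (- {-(lam + c)..lam + c}) x = 0" for x
    by (cases "x \<in> {-(lam + c)..lam + c}") simp_all
  then have "(\<integral>\<^sup>+ x. ennreal (limit_density lam x) * indicator (- {-(lam + c)..lam + c}) x \<partial>lborel) = 0"
    by (simp only: nn_integral_const mult_zero_left)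
  then show "emeasure (limit_law lam) (- {-(lam + c)..lam + c}) = 0"
    using atom_distance lam by (simp add: emeasure_limit_law emeasure_density)
qed (auto simp: sets_limit_law)

lemma limit_law_stieltjes:
  assumes y: "y > lam"
  shows "(LINT x|limit_law lam. 1 / (lam + sqrt (y\<^sup>2 + 2) - x)) = 1 / (lam + y)"
proof -
  interpret real_distribution "limit_law lam" by (rule real_distribution_limit_law)
  define a where "a = sqrt (y\<^sup>2 + 2)"
  have ac: "a > c" unfolding a_def c_def using lam y by (simp add: power_strict_mono)
  let ?g = "\<lambda>x. 1 / (lam + a - x)"
  have I: "(\<integral>\<^sup>+ x. ennreal (limit_density lam x) * ennreal (?g x) \<partial>lborel)
      = ennreal (1 / (lam + y) - lam / c * (1 / (a + c)))"
  proof (rule nn_integral_limit_density)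
    show "((\<lambda>u. 1 / (lam + a - (u + lam)) * (sqrt (2 - u\<^sup>2) / (pi * (c\<^sup>2 - u\<^sup>2))))
      has_integral 1 / (lam + y) - lam / c * (1 / (a + c))) {-sqrt 2..sqrt 2}"
      using ac_stieltjes_integral[OF y, folded a_def] by simp
    show "0 \<le> 1 / (lam + a - (u + lam))" if "u \<in> {-sqrt 2..sqrt 2}" for u
      using that ac atom_distance by simp
  qed simp
  have le: "lam / c * (1 / (a + c)) \<le> 1 / (lam + y)"
  proof -
    have "lam / c * (1 / (a + c)) \<le> 1 * (1 / (lam + y))"
    proof (rule mult_mono)
      have "y \<le> a" unfolding a_def by (rule real_le_rsqrt) simp
      then show "1 / (a + c) \<le> 1 / (lam + y)"
        using atom_distance lam y by (intro divide_left_mono) auto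
    qed (use atom_distance lam ac in auto)
    then show ?thesis by simp
  qed
  have "(\<integral>\<^sup>+ x. ennreal (?g x) \<partial>limit_law lam) =
      ennreal (lam / c) * ennreal (?g (lam - c)) + ennreal (1 / (lam + y) - lam / c * (1 / (a + c)))"
    unfolding I[symmetric] by (rule nn_integral_limit_law) simp
  also have "\<dots> = ennreal (lam / c * (1 / (a + c)) + (1 / (lam + y) - lam / c * (1 / (a + c))))"
    using atom_distance lam ac le by (simp add: ennreal_mult[symmetric] ennreal_plus[symmetric] del: ennreal_plus)
  finally have nn: "(\<integral>\<^sup>+ x. ennreal (?g x) \<partial>limit_law lam) = ennreal (1 / (lam + y))" by simp
  have "has_bochner_integral (limit_law lam) ?g (1 / (lam + y))"
  proof (rule has_bochner_integral_nn_integral[OF _ _ _ nn])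
    show "AE x in limit_law lam. 0 \<le> ?g x"
      by (rule eventually_mono[OF limit_law_support]) (use ac in auto)
  qed (use lam y in auto)
  then show ?thesis unfolding a_def by (rule has_bochner_integral_integral_eq)
qed

lemma free_meixner_law_eq_limit_law: "free_meixner_law lam (1/2) 2 0 = limit_law lam"
proof (rule free_meixner_law_eqI[OF real_distribution_limit_law limit_law_support])
  show "(LINT x|limit_law lam. poly (meixner_poly lam (1/2) 2 0 n) x) = 0" if "n \<ge> 1" for n
    by (rule meixner_mean_zero[OF real_distribution_limit_law limit_law_support _ lam _ limit_law_stieltjes that])
       (use atom_distance lam in auto)
qed simp

end

section \<open>Convergence\<close>

text \<open>For the law with index \<open>m\<close> the transform is known at the point \<open>lam + y\<^sub>m\<close>, which moves with \<open>m\<close>. The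
points converge, and the transforms are equally Lipschitz to the right of the common support, so
the value at the limit point converges as well.\<close>

lemma vacuum_laws_limit_stieltjes:
  fixes lam :: real
  defines "\<mu> \<equiv> \<lambda>n. vacuum_law (\<lambda>f w. T_op (Suc n) (lam * sqrt (real (Suc n))) f w / complex_of_real (sqrt (real (Suc n))))"
  assumes lam: "lam \<ge> 0" and s: "strict_mono s" and \<rho>: "real_distribution \<rho>"
    and wc: "weak_conv_m (\<mu> \<circ> s) \<rho>" and y: "y > 2"
  shows "(LINT x|\<rho>. 1 / (lam + sqrt (y\<^sup>2 + 2) - x)) = 1 / (lam + y)"
proof -
  let ?R = "2 + lam"
  have rd: "real_distribution (\<mu> n)" and supp: "AE x in \<mu> n. x \<in> {-?R..?R}" for n
    unfolding \<mu>_def using vacuum_law_scaled_T[of "Suc n" lam] lam by simp_all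
  have rds: "real_distribution ((\<mu> \<circ> s) n)" and supps: "AE x in (\<mu> \<circ> s) n. x \<in> {-?R..?R}" for n
    by (simp_all only: o_def rd supp)
  define z where "z = lam + sqrt (y\<^sup>2 + 2)"
  define zn where "zn n = lam + euler_seq (Suc n) y (Suc n)" for n
  have "2 < sqrt (y\<^sup>2 + 2)" using y by (intro real_less_rsqrt) (smt (verit) power2_eq_square mult_strict_mono)
  then have z: "?R < z" by (simp add: z_def)
  have zn_ge: "z \<le> zn n" for n
  proof -
    have "y\<^sup>2 + 2 \<le> (euler_seq (Suc n) y (Suc n))\<^sup>2"
      using euler_seq_square[of "Suc n" y "Suc n"] y by (simp del: euler_seq.simps of_nat_Suc)
    then have "sqrt (y\<^sup>2 + 2) \<le> euler_seq (Suc n) y (Suc n)"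
      using euler_seq_ge[of y "Suc n" "Suc n"] y by (intro real_le_lsqrt) auto
    then show ?thesis by (simp add: z_def zn_def del: euler_seq.simps)
  qed
  have zn_lim: "(\<lambda>n. zn n - z) \<longlonglongrightarrow> 0"
    using tendsto_diff[OF euler_seq_limit[of y] tendsto_const[of "sqrt (y\<^sup>2 + 2)"]] y
    by (simp add: zn_def z_def del: euler_seq.simps)
  have val: "(LINT x|\<mu> n. 1 / (zn n - x)) = 1 / (lam + y)" for n
    unfolding \<mu>_def zn_def using vacuum_law_stieltjes[of "Suc n" lam y] lam y by (simp del: euler_seq.simps of_nat_Suc)
  have int: "integrable (\<mu> n) (\<lambda>x. 1 / (w - x))" if "?R < w" for n w
    by (rule integrable_bounded_support[OF rd supp stieltjes_continuous_on[OF that]]) simp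
  have close: "norm ((LINT x|\<mu> n. 1 / (z - x)) - 1 / (lam + y)) \<le> (zn n - z) / (z - ?R)\<^sup>2" for n
  proof -
    interpret real_distribution "\<mu> n" by (rule rd)
    have zR: "?R < zn n" using z zn_ge[of n] by linarith
    have "(LINT x|\<mu> n. 1 / (z - x)) - 1 / (lam + y) = (LINT x|\<mu> n. 1 / (z - x) - 1 / (zn n - x))"
      unfolding val[of n, symmetric] using int[OF z] int[OF zR] by simp
    also have "norm \<dots> \<le> (LINT x|\<mu> n. norm (1 / (z - x) - 1 / (zn n - x)))"
      by (rule integral_norm_bound)
    also have "\<dots> \<le> (LINT x|\<mu> n. (zn n - z) / (z - ?R)\<^sup>2)"
    proof (rule integral_mono_AE)
      show "AE x in \<mu> n. norm (1 / (z - x) - 1 / (zn n - x)) \<le> (zn n - z) / (z - ?R)\<^sup>2"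
      proof (rule eventually_mono[OF supp])
        fix x assume x: "x \<in> {-?R..?R}"
        have p: "z - ?R > 0" "z - x \<ge> z - ?R" "zn n - x \<ge> z - ?R" using z x zn_ge[of n] by auto
        then have "1 / (z - x) - 1 / (zn n - x) = (zn n - z) / ((z - x) * (zn n - x))"
          by (simp add: field_simps)
        moreover have "(zn n - z) / ((z - x) * (zn n - x)) \<le> (zn n - z) / ((z - ?R) * (z - ?R))"
          using p zn_ge[of n] by (intro divide_left_mono mult_mono) auto
        moreover have "0 \<le> (zn n - z) / ((z - x) * (zn n - x))"
          using p zn_ge[of n] by auto
        ultimately show "norm (1 / (z - x) - 1 / (zn n - x)) \<le> (zn n - z) / (z - ?R)\<^sup>2"
          by (simp only: real_norm_def abs_of_nonneg power2_eq_square)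
      qed
    qed (use int[OF z] int[OF zR] in simp_all)
    also have "\<dots> = (zn n - z) / (z - ?R)\<^sup>2"
      by (simp only: lebesgue_integral_const prob_space scaleR_one)
    finally show ?thesis .
  qed
  have "(\<lambda>n. (LINT x|\<mu> n. 1 / (z - x)) - 1 / (lam + y)) \<longlonglongrightarrow> 0"
    by (rule Lim_null_comparison[OF always_eventually tendsto_divide_zero[OF zn_lim]])
       (rule allI, rule close)
  then have "(\<lambda>n. LINT x|\<mu> n. 1 / (z - x)) \<longlonglongrightarrow> 1 / (lam + y)" by (rule LIM_zero_cancel)
  then have 1: "(\<lambda>n. LINT x|(\<mu> \<circ> s) n. 1 / (z - x)) \<longlonglongrightarrow> 1 / (lam + y)"
    using LIMSEQ_subseq_LIMSEQ[OF _ s] by (fastforce simp: o_def)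
  have 2: "(\<lambda>n. LINT x|(\<mu> \<circ> s) n. 1 / (z - x)) \<longlonglongrightarrow> (LINT x|\<rho>. 1 / (z - x))"
    by (rule weak_conv_Icc_integral[OF rds \<rho> wc supps _ stieltjes_continuous_on[OF z]]) (use lam in auto)
  show ?thesis using LIMSEQ_unique[OF 2 1] by (simp add: z_def)
qed

text \<open>By tightness it suffices to identify the limit points. Each of them has the transform of
\<open>limit_law lam\<close>, hence is the same free Meixner law.\<close>

lemma vacuum_laws_weak_conv:
  fixes lam :: real
  assumes lam: "lam > 0"
  shows "weak_conv_m (\<lambda>m. vacuum_law (\<lambda>f w. T_op m (lam * sqrt (real m)) f w / complex_of_real (sqrt (real m))))
    (limit_law lam)"
proof -
  define V where "V m = vacuum_law (\<lambda>f w. T_op m (lam * sqrt (real m)) f w / complex_of_real (sqrt (real m)))" for m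
  \<comment> \<open>The index is shifted because the rescaling by \<open>\<surd>m\<close> is meaningful for \<open>m \<ge> 1\<close> only.\<close>
  let ?\<mu> = "\<lambda>n. V (Suc n)" and ?R = "2 + lam"
  have rd: "real_distribution (?\<mu> n)" and supp: "AE x in ?\<mu> n. x \<in> {-?R..?R}" for n
    unfolding V_def using vacuum_law_scaled_T[of "Suc n" lam] lam by simp_all
  have "weak_conv_m ?\<mu> (limit_law lam)"
  proof (rule tight_subseq_weak_converge[OF rd real_distribution_limit_law[OF lam] tight_Icc[OF rd supp]])
    fix s :: "nat \<Rightarrow> nat" and \<rho>
    assume s: "strict_mono s" and \<rho>: "real_distribution \<rho>" and wc: "weak_conv_m (?\<mu> \<circ> s) \<rho>"
    have supp\<rho>: "AE x in \<rho>. x \<in> {-?R..?R}"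
      by (rule weak_conv_Icc_support[OF _ \<rho> wc]) (simp_all only: o_def rd supp, use lam in simp)
    have st: "(LINT x|\<rho>. 1 / (lam + sqrt (y\<^sup>2 + 2) - x)) = 1 / (lam + y)" if "y > 2" for y
      by (rule vacuum_laws_limit_stieltjes[OF _ s \<rho> _ that]) (use lam wc in \<open>simp_all add: V_def\<close>)
    have "free_meixner_law lam (1/2) 2 0 = \<rho>"
      by (rule free_meixner_law_eqI[OF \<rho> supp\<rho>], simp,
          rule meixner_mean_zero[OF \<rho> supp\<rho> _ lam _ st]) (use lam in auto)
    then have "\<rho> = limit_law lam" using free_meixner_law_eq_limit_law[OF lam] by simp
    with wc show "weak_conv_m (?\<mu> \<circ> s) (limit_law lam)" by simp
  qed
  then have "weak_conv_m V (limit_law lam)"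
    unfolding weak_conv_m_def weak_conv_def by (blast intro: LIMSEQ_imp_Suc)
  then show ?thesis unfolding V_def .
qed

theorem theorem4p1:
  fixes lam :: real
  assumes "lam > 0"
  shows "let \<nu> = free_meixner_law lam (1/2) 2 0 in
    weak_conv_m
      (\<lambda>m. vacuum_law (\<lambda>f w. T_op m (lam * sqrt (real m)) f w / complex_of_real (sqrt (real m)))) \<nu> \<and>
    sets \<nu> = sets borel \<and>
    (\<forall>B\<in>sets borel. emeasure \<nu> B =
       ennreal (lam / sqrt (lam\<^sup>2 + 2)) * emeasure (return borel (lam - sqrt (lam\<^sup>2 + 2))) B
       + emeasure (density lborel (\<lambda>x. ennreal
           (sqrt (2 - (x - lam)\<^sup>2) / (pi * (lam\<^sup>2 + 2 - (x - lam)\<^sup>2))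
            * indicator {lam - sqrt 2 <..< lam + sqrt 2} x))) B)"
  unfolding Let_def free_meixner_law_eq_limit_law[OF assms] limit_density_def[symmetric]
  using vacuum_laws_weak_conv[OF assms] sets_limit_law[OF assms] emeasure_limit_law[OF assms]
  by blast

end
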